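(* Let $m$ be an odd positive integer, $k\ge0$ an integer, $N=k+\frac{m-1}{2}$, and let $P_k(\underline x)$ be an $\mathbb R_{0,m}$-valued homogeneous polynomial of degree $k$ on $\mathbb R^m$ with $\partial_{\underline x}P_k=0$. Then a closed formula for the Cauchy–Kowalevski extension of $\exp(-|\underline x|^2)P_k(\underline x)$ is \begin{multline*} \mathsf{CK}\left[\exp\left(-|\underline x|^2\right)P_k(\underline x)\right](x_0,\underline x)=\frac{\mathsf{Ft}\left[\exp(z^2),P_k(\underline x)\right](x_0,\underline x)}{(-2)^{N}(2k+m-1)!!}\\ =\exp\left(x_0^2-r^2\right)\left(\sum_{j=0}^{N}\binom{N}{j}(-2)^{-j}D_r(j)[\cos(2x_0r)]+\underline\omega\sum_{j=0}^{N}\binom{N}{j}(-2)^{-j}D^r(j)[\sin(2x_0r)]\right)P_k(\underline x). \end{multline*}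
   Context: $\mathbb R_{0,m}$ is the real Clifford algebra generated by $e_1,\dots,e_m$ with $e_je_k+e_ke_j=-2\delta_{jk}$; $\underline x\in\mathbb R^m$ is identified with $\sum_j x_je_j$. Write $r=|\underline x|$, $\underline\omega=\underline x/r$; points of $\mathbb R^{m+1}$ are $(x_0,\underline x)$. Dirac operator $\partial_{\underline x}=\sum_{j=1}^m e_j\partial_{x_j}$; a $C^1$ $\mathbb R_{0,m}$-valued function $f$ on an open subset of $\mathbb R^{m+1}$ is monogenic if $(\partial_{x_0}+\partial_{\underline x})f=0$. For $g$ real-analytic and $\mathbb R_{0,m}$-valued on an open $\underline\Omega\subset\mathbb R^m$, $\mathsf{CK}[g](x_0,\underline x)=\sum_{n\ge0}\frac{(-x_0)^n}{n!}\partial_{\underline x}^ng(\underline x)$ is its unique monogenic extension to a neighbourhood of $\underline\Omega$ in $\mathbb R^{m+1}$. Fueter map: for $h(z)=u(x,y)+iv(x,y)$ holomorphic on an open subset $\Xi$ of the upper half plane, $\mathsf{Ft}[h(z),P_k(\underline x)](x_0,\underline x)=\Delta^{k+\frac{m-1}{2}}[(u(x_0,r)+\underline\omega\,v(x_0,r))P_k(\underline x)]$ with $\Delta=\sum_{j=0}^m\partial_{x_j}^2$, defined where $(x_0,r)\in\Xi$. The operators in the variable $r>0$ are $D_r(n)[f]=(r^{-1}\partial_r)^nf$ and $D^r(n)[f]=(\partial_r\circ r^{-1})^nf$ (i.e. $n$-fold application of $f\mapsto\partial_r(f/r)$), with $D_r(0)=D^r(0)=\mathrm{id}$. Double factorials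 use $(-1)!!=0!!=1$. *)

theory Defs
  imports "HOL-Analysis.Analysis"
begin

text \<open>Conventions.  An element of the Clifford algebra R_{0,m} is represented as a
function  a :: nat set \<Rightarrow> real  giving the coefficient of the basis blade e_A,
A \<subseteq> {1..m}.  A point (x0, x) of R^{m+1} is represented as y :: nat \<Rightarrow> real with
x0 = y 0 and x_j = y j for j = 1..m (other coordinates are ignored).\<close>

type_synonym clif = "nat set \<Rightarrow> real"

text \<open>Sign of e_A e_B: reorder (anticommutation) and e_j e_j = -1.\<close>
definition blade_sign :: "nat set \<Rightarrow> nat set \<Rightarrow> real" where
  "blade_sign A B = (-1) ^ (card {(a, b). a \<in> A \<and> b \<in> B \<and> b < a} + card (A \<inter> B))"

definition cmul :: "nat \<Rightarrow> clif \<Rightarrow> clif \<Rightarrow> clif" where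
  "cmul m a b = (\<lambda>C. \<Sum>A\<in>Pow {1..m}. \<Sum>B\<in>Pow {1..m}.
       (if (A - B) \<union> (B - A) = C then blade_sign A B * a A * b B else 0))"

definition cscal :: "real \<Rightarrow> clif" where
  "cscal c = (\<lambda>A. if A = {} then c else 0)"

definition cbasis :: "nat \<Rightarrow> clif" where
  "cbasis j = (\<lambda>A. if A = {j} then 1 else 0)"

definition cvec :: "nat \<Rightarrow> (nat \<Rightarrow> real) \<Rightarrow> clif" where
  "cvec m y = (\<lambda>A. \<Sum>j\<in>{1..m}. y j * cbasis j A)"

definition vnorm :: "nat \<Rightarrow> (nat \<Rightarrow> real) \<Rightarrow> real" where
  "vnorm m y = sqrt (\<Sum>j\<in>{1..m}. (y j)\<^sup>2)"

definition comega :: "nat \<Rightarrow> (nat \<Rightarrow> real) \<Rightarrow> clif" where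
  "comega m y = (\<lambda>A. cvec m y A / vnorm m y)"

definition cpartial :: "nat \<Rightarrow> ((nat \<Rightarrow> real) \<Rightarrow> clif) \<Rightarrow> (nat \<Rightarrow> real) \<Rightarrow> clif" where
  "cpartial j F y = (\<lambda>A. deriv (\<lambda>t. F (y(j := t)) A) (y j))"

definition dirac :: "nat \<Rightarrow> ((nat \<Rightarrow> real) \<Rightarrow> clif) \<Rightarrow> (nat \<Rightarrow> real) \<Rightarrow> clif" where
  "dirac m F y = (\<lambda>C. \<Sum>j\<in>{1..m}. cmul m (cbasis j) (cpartial j F y) C)"

definition laplace :: "nat \<Rightarrow> ((nat \<Rightarrow> real) \<Rightarrow> clif) \<Rightarrow> (nat \<Rightarrow> real) \<Rightarrow> clif" where
  "laplace m F y = (\<lambda>C. \<Sum>j\<in>{0..m}. cpartial j (cpartial j F) y C)"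

definition CK :: "nat \<Rightarrow> ((nat \<Rightarrow> real) \<Rightarrow> clif) \<Rightarrow> (nat \<Rightarrow> real) \<Rightarrow> clif" where
  "CK m g y = (\<lambda>A. \<Sum>n. (- y 0) ^ n / fact n * ((dirac m ^^ n) g) y A)"

text \<open>Fueter map: h = u + i v holomorphic; m odd.\<close>
definition Ft :: "nat \<Rightarrow> nat \<Rightarrow> (complex \<Rightarrow> complex) \<Rightarrow> ((nat \<Rightarrow> real) \<Rightarrow> clif)
                  \<Rightarrow> (nat \<Rightarrow> real) \<Rightarrow> clif" where
  "Ft m k h P = (laplace m ^^ (k + (m - 1) div 2))
     (\<lambda>y. cmul m (\<lambda>A. cscal (Re (h (Complex (y 0) (vnorm m y)))) A
                       + Im (h (Complex (y 0) (vnorm m y))) * comega m y A) (P y))"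

definition D_r :: "nat \<Rightarrow> (real \<Rightarrow> real) \<Rightarrow> real \<Rightarrow> real" where
  "D_r n f = ((\<lambda>g s. deriv g s / s) ^^ n) f"

definition D_up :: "nat \<Rightarrow> (real \<Rightarrow> real) \<Rightarrow> real \<Rightarrow> real" where
  "D_up n f = ((\<lambda>g s. deriv (\<lambda>t. g t / t) s) ^^ n) f"

fun dfact :: "nat \<Rightarrow> nat" where
  "dfact 0 = 1"
| "dfact (Suc 0) = 1"
| "dfact (Suc (Suc n)) = Suc (Suc n) * dfact n"

definition multiidx :: "nat \<Rightarrow> nat \<Rightarrow> (nat \<Rightarrow> nat) set" where
  "multiidx m k = {\<alpha>. (\<forall>j. j \<notin> {1..m} \<longrightarrow> \<alpha> j = 0) \<and> (\<Sum>j\<in>{1..m}. \<alpha> j) = k}"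

definition homog_clif_poly :: "nat \<Rightarrow> nat \<Rightarrow> ((nat \<Rightarrow> real) \<Rightarrow> clif) \<Rightarrow> bool" where
  "homog_clif_poly m k P \<longleftrightarrow> (\<exists>c :: (nat \<Rightarrow> nat) \<Rightarrow> clif.
      (\<forall>\<alpha> A. \<not> A \<subseteq> {1..m} \<longrightarrow> c \<alpha> A = 0) \<and>
      (\<forall>x. P x = (\<lambda>A. \<Sum>\<alpha>\<in>multiidx m k. c \<alpha> A * (\<Prod>j\<in>{1..m}. x j ^ \<alpha> j))))"

end

theory Submission
  imports Defs "HOL-Complex_Analysis.Cauchy_Integral_Formula"
begin

text \<open>
  Put \<open>Q = x P\<close>. Both \<open>P\<close> and \<open>Q\<close> have harmonic homogeneous components, so on combinations
  \<open>g(t, r) P + w(t, r) Q\<close> the Dirac operator and the Laplacian become ordinary differential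
  operators in \<open>r\<close>. With \<open>c = 2 k + m\<close>, the combination is monogenic iff
  \<open>g_t = r w_r + c w\<close> and \<open>w_t = - g_r / r\<close>. For \<open>c = 1\<close> these are the Cauchy--Riemann
  equations of \<open>g + i r w\<close>, and applying \<open>(1/r) d/dr\<close> to both \<open>g\<close> and \<open>w\<close> raises \<open>c\<close> by 2.
  The Laplacian acts on a pair with parameter \<open>c\<close> as
  \<open>2 k + m - c\<close> times \<open>(1/r) d/dr\<close>, so \<open>N\<close> Laplacians take \<open>exp (z\<^sup>2)\<close> to a multiple of a
  monogenic combination. Its restriction to \<open>t = 0\<close> is a multiple of \<open>exp (- r\<^sup>2) P\<close>, and as it is
  entire in \<open>t\<close>, its Taylor series there is the Cauchy--Kowalevski series.
\<close>

subsection \<open>Multiplication by vectors in the Clifford algebra\<close>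

text \<open>The index of the blade e_j e_C up to sign, that is, the symmetric difference of
  \<open>C\<close> with the singleton of \<open>j\<close>.\<close>

definition flip :: "nat \<Rightarrow> nat set \<Rightarrow> nat set" where
  "flip j C = (if j \<in> C then C - {j} else insert j C)"

text \<open>The sign in e_j e_B = sign e_C for \<open>B = flip j C\<close>. It is indexed by the
  resulting blade \<open>C\<close>; the last factor is the -1 of e_j e_j, which occurs when
  \<open>j\<close> lies in \<open>B\<close>.\<close>

definition flip_sign :: "nat \<Rightarrow> nat set \<Rightarrow> real" where
  "flip_sign j C = (-1) ^ card {b \<in> C. b < j} * (if j \<in> C then 1 else -1)"

lemma flip_subset: "j \<in> S \<Longrightarrow> flip j C \<subseteq> S \<longleftrightarrow> C \<subseteq> S"
  by (auto simp: flip_def)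

lemma flip_flip [simp]: "flip j (flip j C) = C"
  by (auto simp: flip_def)

lemma flip_commute: "flip i (flip j C) = flip j (flip i C)"
  by (auto simp: flip_def)

lemma sym_diff_singleton_iff: "({j} - B) \<union> (B - {j}) = C \<longleftrightarrow> B = flip j C"
  by (auto simp: flip_def)

lemma flip_sign_flip_same: "flip_sign j C * flip_sign j (flip j C) = -1"
proof -
  have "{b \<in> flip j C. b < j} = {b \<in> C. b < j}"
    by (auto simp: flip_def split: if_splits)
  moreover have "(-1::real) ^ n * (-1) ^ n = 1" for n
    by (simp flip: power_add mult_2)
  ultimately show ?thesis
    by (auto simp: flip_sign_def flip_def)
qed

lemma flip_sign_flip_above:
  assumes "i < j"
  shows "flip_sign i (flip j C) = flip_sign i C"
proof -
  have "{b \<in> flip j C. b < i} = {b \<in> C. b < i}" "i \<in> flip j C \<longleftrightarrow> i \<in> C"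
    using assms by (auto simp: flip_def split: if_splits)
  then show ?thesis
    by (simp add: flip_sign_def)
qed

lemma flip_sign_flip_below:
  assumes "i < j"
  shows "flip_sign j (flip i C) = - flip_sign j C"
proof -
  have fin: "finite {b \<in> C. b < j}"
    by auto
  have mem: "j \<in> flip i C \<longleftrightarrow> j \<in> C"
    using assms by (auto simp: flip_def split: if_splits)
  have "(-1::real) ^ card {b \<in> flip i C. b < j} = - ((-1) ^ card {b \<in> C. b < j})"
  proof (cases "i \<in> C")
    case True
    then have "{b \<in> C. b < j} = insert i {b \<in> flip i C. b < j}"
      "i \<notin> {b \<in> flip i C. b < j}"
      using assms by (auto simp: flip_def)
    then show ?thesis
      by (simp add: card_insert_if)
  next
    case False
    then have "{b \<in> flip i C. b < j} = insert i {b \<in> C. b < j}" "i \<notin> {b \<in> C. b < j}"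
      using assms by (auto simp: flip_def)
    then show ?thesis
      using fin by (simp add: card_insert_if)
  qed
  with mem show ?thesis
    by (simp add: flip_sign_def)
qed

text \<open>Sign form of e_i e_j = - e_j e_i: flipping the smaller index changes by one the number
  of elements below the larger, while flipping the larger leaves the count below the smaller
  alone.\<close>

lemma flip_sign_anticommute:
  assumes "i \<noteq> j"
  shows "flip_sign i C * flip_sign j (flip i C) = - (flip_sign j C * flip_sign i (flip j C))"
  using assms flip_sign_flip_above flip_sign_flip_below
  by (cases "i < j") (auto simp: not_less order_less_le)

lemma blade_sign_flip: "blade_sign {j} (flip j C) = flip_sign j C"
proof -
  have "{(a, b). a \<in> {j} \<and> b \<in> flip j C \<and> b < a} = Pair j ` {b \<in> C. b < j}"
    by (auto simp: flip_def split: if_splits)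
  then have "card {(a, b). a \<in> {j} \<and> b \<in> flip j C \<and> b < a} = card {b \<in> C. b < j}"
    by (simp add: card_image inj_on_def)
  then show ?thesis
    by (auto simp: blade_sign_def flip_sign_def flip_def power_add)
qed

text \<open>Only one blade of \<open>a\<close> reaches the component \<open>C\<close>. The case
  split reflects that \<open>cmul\<close> sums over subsets of \<open>{1..m}\<close> only, so every
  other component is 0.\<close>

lemma cmul_cbasis:
  assumes "j \<in> {1..m}"
  shows "cmul m (cbasis j) a C = (if C \<subseteq> {1..m} then flip_sign j C * a (flip j C) else 0)"
proof -
  have "cmul m (cbasis j) a C = (\<Sum>A\<in>Pow {1..m}. if A = {j} then
      \<Sum>B\<in>Pow {1..m}. if B = flip j C then blade_sign {j} B * a B else 0 else 0)"
    unfolding cmul_def cbasis_def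
    by (intro sum.cong refl) (simp flip: sym_diff_singleton_iff cong: if_cong)
  also have "\<dots> = (if C \<subseteq> {1..m} then flip_sign j C * a (flip j C) else 0)"
    using assms by (simp add: flip_subset blade_sign_flip)
  finally show ?thesis .
qed

lemma cmul_add_left: "cmul m (\<lambda>A. a A + b A) p C = cmul m a p C + cmul m b p C"
  unfolding cmul_def sum.distrib[symmetric] by (intro sum.cong refl) (simp add: algebra_simps)

lemma cmul_scale_left: "cmul m (\<lambda>A. c * a A) p C = c * cmul m a p C"
  unfolding cmul_def sum_distrib_left by (intro sum.cong refl) simp

lemma cmul_zero_left: "cmul m (\<lambda>A. 0) p C = 0"
  by (simp add: cmul_def cong: if_cong)

lemma cmul_sum_left:
  "finite I \<Longrightarrow> cmul m (\<lambda>A. \<Sum>i\<in>I. a i A) p C = (\<Sum>i\<in>I. cmul m (a i) p C)"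
  by (induction I rule: finite_induct) (simp_all add: cmul_zero_left cmul_add_left)

lemma cmul_cscal:
  assumes "\<And>A. \<not> A \<subseteq> {1..m} \<Longrightarrow> p A = 0"
  shows "cmul m (cscal c) p C = c * p C"
proof -
  have "cmul m (cscal c) p C = (\<Sum>A\<in>Pow {1..m}. if A = {} then
      \<Sum>B\<in>Pow {1..m}. if B = C then c * p B else 0 else 0)"
    unfolding cmul_def cscal_def by (intro sum.cong refl) (simp add: blade_sign_def cong: if_cong)
  also have "\<dots> = c * p C"
    using assms by simp
  finally show ?thesis .
qed

lemma cmul_cvec: "cmul m (cvec m y) p C = (\<Sum>j\<in>{1..m}. y j * cmul m (cbasis j) p C)"
proof -
  have "cmul m (cvec m y) p C = cmul m (\<lambda>A. \<Sum>j\<in>{1..m}. y j * cbasis j A) p C"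
    by (simp add: cvec_def[abs_def])
  also have "\<dots> = (\<Sum>j\<in>{1..m}. y j * cmul m (cbasis j) p C)"
    by (subst cmul_sum_left) (simp_all add: cmul_scale_left)
  finally show ?thesis .
qed

lemma cmul_cscal_comega:
  assumes "\<And>A. \<not> A \<subseteq> {1..m} \<Longrightarrow> p A = 0"
  shows "cmul m (\<lambda>A. cscal a A + b * comega m y A) p C =
    a * p C + b / vnorm m y * cmul m (cvec m y) p C"
proof -
  have "b * comega m y A = b / vnorm m y * cvec m y A" for A
    by (simp add: comega_def)
  moreover have "cmul m (cscal a) p C = a * p C"
    using assms by (rule cmul_cscal)
  ultimately show ?thesis
    by (simp only: cmul_add_left cmul_scale_left)
qed

lemma cmul_cvec_flip:
  "cmul m (cvec m y) p C =
    (if C \<subseteq> {1..m} then \<Sum>j\<in>{1..m}. flip_sign j C * (y j * p (flip j C)) else 0)"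
  by (simp add: cmul_cvec cmul_cbasis mult.left_commute del: One_nat_def)

text \<open>The double sum is the component at \<open>C\<close> of \<open>\<Sum>i j. e_i e_j T i j\<close>.\<close>
lemma flip_sum_anticommute:
  fixes T :: "nat \<Rightarrow> nat \<Rightarrow> nat set \<Rightarrow> real" and C :: "nat set"
  assumes "finite I"
  defines "S \<equiv> \<lambda>T. \<Sum>i\<in>I. \<Sum>j\<in>I. flip_sign i C * flip_sign j (flip i C) * T i j (flip j (flip i C))"
  shows "S T + S (\<lambda>i j. T j i) = - 2 * (\<Sum>i\<in>I. T i i C)"
proof -
  let ?s = "\<lambda>i j. flip_sign i C * flip_sign j (flip i C)"
  have "S (\<lambda>i j. T j i) = (\<Sum>i\<in>I. \<Sum>j\<in>I. ?s j i * T i j (flip i (flip j C)))"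
    unfolding S_def by (rule sum.swap)
  \<comment> \<open>After the swap both sums contain the same values of \<open>T\<close>, and e_i
    e_j + e_j e_i = -2 delta_ij leaves only the diagonal.\<close>
  then have "S T + S (\<lambda>i j. T j i) = (\<Sum>i\<in>I. \<Sum>j\<in>I. (?s i j + ?s j i) * T i j (flip j (flip i C)))"
    by (simp add: S_def sum.distrib distrib_right flip_commute)
  also have "\<dots> = (\<Sum>i\<in>I. \<Sum>j\<in>I. if i = j then - 2 * T i i C else 0)"
  proof (intro sum.cong refl)
    fix i j
    show "(?s i j + ?s j i) * T i j (flip j (flip i C)) = (if i = j then - 2 * T i i C else 0)"
      using flip_sign_anticommute[of i j C] flip_sign_flip_same[of i C] by (cases "i = j") simp_all
  qed
  also have "\<dots> = - 2 * (\<Sum>i\<in>I. T i i C)"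
    using assms(1) by (simp add: sum_distrib_left)
  finally show ?thesis .
qed

text \<open>The coefficients \<open>y i * y j\<close> are symmetric, so the two sums in the
  anticommutation lemma coincide, which gives x^2 = -r^2.\<close>

lemma cvec_mul_cvec:
  assumes "\<And>A. \<not> A \<subseteq> {1..m} \<Longrightarrow> p A = 0"
  shows "cmul m (cvec m y) (cmul m (cvec m y) p) C = - (vnorm m y)\<^sup>2 * p C"
proof (cases "C \<subseteq> {1..m}")
  case True
  then have "cmul m (cvec m y) (cmul m (cvec m y) p) C =
     (\<Sum>i\<in>{1..m}. \<Sum>j\<in>{1..m}. flip_sign i C * flip_sign j (flip i C) * (y i * y j * p (flip j (flip i C))))"
    by (simp add: cmul_cvec_flip flip_subset sum_distrib_left mult_ac del: One_nat_def)
  also have "\<dots> = - (\<Sum>i\<in>{1..m}. y i * y i * p C)"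
    using flip_sum_anticommute[of "{1..m}" C "\<lambda>i j A. y i * y j * p A"] by (simp add: mult_ac)
  also have "\<dots> = - (vnorm m y)\<^sup>2 * p C"
    by (simp add: vnorm_def sum_nonneg power2_eq_square sum_distrib_right)
  finally show ?thesis .
next
  case False
  with assms show ?thesis
    by (simp add: cmul_cvec_flip)
qed

subsection \<open>Partial derivatives of polynomial functions\<close>

definition pd :: "nat \<Rightarrow> ((nat \<Rightarrow> real) \<Rightarrow> real) \<Rightarrow> (nat \<Rightarrow> real) \<Rightarrow> real" where
  "pd j f y = deriv (\<lambda>t. f (y(j := t))) (y j)"

lemma cpartial_eq_pd: "cpartial j F y A = pd j (\<lambda>x. F x A) y"
  by (simp add: cpartial_def pd_def)

lemma pd_eqI: "((\<lambda>t. f (y(j := t))) has_real_derivative d) (at (y j)) \<Longrightarrow> pd j f y = d"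
  by (simp add: pd_def DERIV_imp_deriv)

lemma laplace_pd: "laplace m F y C = (\<Sum>j\<in>{0..m}. pd j (pd j (\<lambda>x. F x C)) y)"
  by (simp add: laplace_def cpartial_eq_pd[abs_def] cpartial_eq_pd)

lemma dirac_flip:
  "dirac m F y C = (if C \<subseteq> {1..m}
     then \<Sum>j\<in>{1..m}. flip_sign j C * pd j (\<lambda>x. F x (flip j C)) y else 0)"
  by (simp add: dirac_def cmul_cbasis cpartial_eq_pd del: One_nat_def)

text \<open>Only the coordinates 1 to m are generators, so such functions do not see the time
  coordinate \<open>y 0\<close>. Differentiability, closure under \<open>pd\<close> and symmetry of
  mixed partials all follow by structural induction.\<close>

inductive polyfun :: "nat \<Rightarrow> ((nat \<Rightarrow> real) \<Rightarrow> real) \<Rightarrow> bool" for m where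
  const: "polyfun m (\<lambda>x. c)"
| coord: "j \<in> {1..m} \<Longrightarrow> polyfun m (\<lambda>x. x j)"
| add: "polyfun m f \<Longrightarrow> polyfun m g \<Longrightarrow> polyfun m (\<lambda>x. f x + g x)"
| mult: "polyfun m f \<Longrightarrow> polyfun m g \<Longrightarrow> polyfun m (\<lambda>x. f x * g x)"

lemma has_derivative_coord:
  "((\<lambda>t. (y(j := t)) i) has_real_derivative (if i = j then 1 else 0)) (at (y j))"
  by auto

lemma polyfun_differentiable:
  "polyfun m f \<Longrightarrow> ((\<lambda>t. f (y(j := t))) has_real_derivative pd j f y) (at (y j))"
proof -
  assume "polyfun m f"
  then have "\<exists>d. ((\<lambda>t. f (y(j := t))) has_real_derivative d) (at (y j))"
  proof induction
    case (coord i)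
    show ?case
      by (rule exI, rule has_derivative_coord)
  qed (auto intro: DERIV_const DERIV_add DERIV_mult)
  then show ?thesis
    using pd_eqI by metis
qed

lemma pd_const [simp]: "pd j (\<lambda>x. c) = (\<lambda>x. 0)"
  by (intro ext pd_eqI DERIV_const)

lemma pd_coord [simp]: "pd j (\<lambda>x. x i) = (\<lambda>x. if i = j then 1 else 0)"
  by (intro ext pd_eqI has_derivative_coord)

lemma pd_add:
  assumes "polyfun m f" "polyfun m g"
  shows "pd j (\<lambda>x. f x + g x) = (\<lambda>x. pd j f x + pd j g x)"
  by (intro ext pd_eqI DERIV_add polyfun_differentiable[OF assms(1)] polyfun_differentiable[OF assms(2)])

lemma pd_mult:
  assumes "polyfun m f" "polyfun m g"
  shows "pd j (\<lambda>x. f x * g x) = (\<lambda>x. pd j f x * g x + f x * pd j g x)"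
proof (intro ext pd_eqI)
  fix y
  show "((\<lambda>t. f (y(j := t)) * g (y(j := t))) has_real_derivative
      pd j f y * g y + f y * pd j g y) (at (y j))"
    using DERIV_mult[OF polyfun_differentiable[OF assms(1), of y j] polyfun_differentiable[OF assms(2), of y j]]
    by (simp add: algebra_simps)
qed

lemma polyfun_pd: "polyfun m f \<Longrightarrow> polyfun m (pd j f)"
  by (induction rule: polyfun.induct)
    (auto simp: pd_add pd_mult intro: polyfun.intros)

lemma pd_commute: "polyfun m f \<Longrightarrow> pd i (pd j f) = pd j (pd i f)"
  by (induction rule: polyfun.induct)
    (auto simp: pd_add[of m] pd_mult[of m] polyfun.add polyfun.mult polyfun_pd)

lemma polyfun_sum: "(\<And>i. i \<in> I \<Longrightarrow> polyfun m (f i)) \<Longrightarrow> polyfun m (\<lambda>x. \<Sum>i\<in>I. f i x)"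
  by (induction I rule: infinite_finite_induct) (auto intro: polyfun.intros)

lemma pd_sum:
  "(\<And>i. i \<in> I \<Longrightarrow> polyfun m (f i)) \<Longrightarrow> pd j (\<lambda>x. \<Sum>i\<in>I. f i x) = (\<lambda>x. \<Sum>i\<in>I. pd j (f i) x)"
  by (induction I rule: infinite_finite_induct) (simp_all add: pd_add[of m] polyfun_sum)

lemma pd_cmult: "polyfun m f \<Longrightarrow> pd j (\<lambda>x. c * f x) = (\<lambda>x. c * pd j f x)"
  by (simp add: pd_mult[of m] polyfun.const)

lemma polyfun_power: "polyfun m f \<Longrightarrow> polyfun m (\<lambda>x. f x ^ n)"
  by (induction n) (auto intro: polyfun.intros)

lemma polyfun_prod: "(\<And>i. i \<in> I \<Longrightarrow> polyfun m (f i)) \<Longrightarrow> polyfun m (\<lambda>x. \<Prod>i\<in>I. f i x)"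
  by (induction I rule: infinite_finite_induct) (auto intro: polyfun.intros)

lemma polyfun_upd_0: "polyfun m f \<Longrightarrow> f (y(0 := t)) = f y"
  by (induction rule: polyfun.induct) auto

text \<open>The factor \<open>x j\<close> restores the exponent lowered by differentiation, so that
  Euler's identity becomes a sum over exponents.\<close>

lemma pd_monomial:
  assumes "j \<in> {1..m}"
  shows "x j * pd j (\<lambda>x. \<Prod>i\<in>{1..m}. x i ^ \<alpha> i) x = real (\<alpha> j) * (\<Prod>i\<in>{1..m}. x i ^ \<alpha> i)"
proof -
  let ?R = "\<Prod>i\<in>{1..m} - {j}. x i ^ \<alpha> i"
  have split: "(\<Prod>i\<in>{1..m}. (x(j := t)) i ^ \<alpha> i) = t ^ \<alpha> j * ?R" for t
    using assms by (subst prod.remove[of _ j]) (auto intro!: prod.cong)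
  have "((\<lambda>t. t ^ \<alpha> j * ?R) has_real_derivative (real (\<alpha> j) * x j ^ (\<alpha> j - 1)) * ?R) (at (x j))"
    by (auto intro!: derivative_eq_intros)
  then have "pd j (\<lambda>x. \<Prod>i\<in>{1..m}. x i ^ \<alpha> i) x = real (\<alpha> j) * x j ^ (\<alpha> j - 1) * ?R"
    by (intro pd_eqI) (simp only: split)
  moreover have "(\<Prod>i\<in>{1..m}. x i ^ \<alpha> i) = x j ^ \<alpha> j * ?R"
    using split[of "x j"] by simp
  ultimately show ?thesis
    by (cases "\<alpha> j") simp_all
qed

subsection \<open>Homogeneous monogenic polynomials\<close>

text \<open>Homogeneity of degree \<open>d\<close> enters as Euler's identity, the form in which the
  Laplacian computation uses it. The locale serves each component of \<open>P\<close> (degree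
  \<open>k\<close>) and of x P (degree \<open>k + 1\<close>).\<close>

locale solid_harmonic =
  fixes m d :: nat and q :: "(nat \<Rightarrow> real) \<Rightarrow> real"
  assumes polyfun: "polyfun m q"
    and euler: "(\<Sum>j\<in>{1..m}. x j * pd j q x) = real d * q x"
    and harmonic: "(\<Sum>j\<in>{1..m}. pd j (pd j q) x) = 0"

locale monogenic_poly =
  fixes m k :: nat and P :: "(nat \<Rightarrow> real) \<Rightarrow> clif"
  assumes homog: "homog_clif_poly m k P"
    and monogenic: "dirac m P x = (\<lambda>A. 0)"
begin

lemma P_outside: "\<not> A \<subseteq> {1..m} \<Longrightarrow> P x A = 0"
  using homog unfolding homog_clif_poly_def by (metis (no_types, lifting) mult_zero_left sum.neutral)

lemma polyfun_P: "polyfun m (\<lambda>x. P x A)"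
  using homog unfolding homog_clif_poly_def
  by (auto intro!: polyfun_sum polyfun.mult polyfun.const polyfun_prod polyfun_power polyfun.coord
      simp del: One_nat_def)

text \<open>Each monomial is an eigenfunction of the Euler operator, with its total degree as
  eigenvalue.\<close>

lemma euler_P: "(\<Sum>j\<in>{1..m}. x j * pd j (\<lambda>x. P x A) x) = real k * P x A"
proof -
  obtain c where c: "P = (\<lambda>x A. \<Sum>\<alpha>\<in>multiidx m k. c \<alpha> A * (\<Prod>j\<in>{1..m}. x j ^ \<alpha> j))"
    using homog unfolding homog_clif_poly_def by blast
  have poly: "polyfun m (\<lambda>x. \<Prod>i\<in>{1..m}. x i ^ \<alpha> i)" for \<alpha>
    by (intro polyfun_prod polyfun_power polyfun.coord)
  have "(\<Sum>j\<in>{1..m}. x j * pd j (\<lambda>x. P x A) x) =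
     (\<Sum>j\<in>{1..m}. \<Sum>\<alpha>\<in>multiidx m k. c \<alpha> A * (real (\<alpha> j) * (\<Prod>j\<in>{1..m}. x j ^ \<alpha> j)))"
  proof (intro sum.cong refl)
    fix j assume j: "j \<in> {1..m}"
    have "pd j (\<lambda>x. P x A) x = (\<Sum>\<alpha>\<in>multiidx m k. c \<alpha> A * pd j (\<lambda>x. \<Prod>i\<in>{1..m}. x i ^ \<alpha> i) x)"
      unfolding c by (subst pd_sum[of _ m]) (intro polyfun.mult polyfun.const poly, simp only: pd_cmult[OF poly])
    then show "x j * pd j (\<lambda>x. P x A) x =
      (\<Sum>\<alpha>\<in>multiidx m k. c \<alpha> A * (real (\<alpha> j) * (\<Prod>j\<in>{1..m}. x j ^ \<alpha> j)))"
      by (simp only: sum_distrib_left pd_monomial[OF j, symmetric] mult.left_commute)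
  qed
  also have "\<dots> = (\<Sum>\<alpha>\<in>multiidx m k. (\<Sum>j\<in>{1..m}. real (\<alpha> j)) * (c \<alpha> A * (\<Prod>j\<in>{1..m}. x j ^ \<alpha> j)))"
    by (subst sum.swap, intro sum.cong refl, unfold sum_distrib_right, intro sum.cong refl) simp
  also have "\<dots> = (\<Sum>\<alpha>\<in>multiidx m k. real k * (c \<alpha> A * (\<Prod>j\<in>{1..m}. x j ^ \<alpha> j)))"
    by (intro sum.cong refl) (simp add: multiidx_def flip: of_nat_sum)
  also have "\<dots> = real k * P x A"
    by (simp add: c sum_distrib_left)
  finally show ?thesis .
qed

lemma monogenic_flip:
  assumes "C \<subseteq> {1..m}"
  shows "(\<Sum>j\<in>{1..m}. flip_sign j C * pd j (\<lambda>x. P x (flip j C)) x) = 0"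
  using fun_cong[OF monogenic, of x C] assms by (simp add: dirac_flip)

text \<open>The square of the Dirac operator is minus the Laplacian, so the components of a
  monogenic polynomial are harmonic.\<close>

lemma harmonic_P: "(\<Sum>j\<in>{1..m}. pd j (pd j (\<lambda>x. P x C)) x) = 0"
proof (cases "C \<subseteq> {1..m}")
  case True
  let ?T = "\<lambda>i j A. pd i (pd j (\<lambda>x. P x A)) x"
  have "(\<Sum>j\<in>{1..m}. flip_sign j (flip i C) * ?T i j (flip j (flip i C))) = 0" if "i \<in> {1..m}" for i
  proof -
    have "pd i (\<lambda>x. \<Sum>j\<in>{1..m}. flip_sign j (flip i C) * pd j (\<lambda>x. P x (flip j (flip i C))) x) x = 0"
      using True that by (simp add: monogenic_flip flip_subset del: One_nat_def)
    then show ?thesis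
      by (simp add: pd_sum[of _ m] pd_cmult[of m] polyfun.mult polyfun.const polyfun_pd polyfun_P)
  qed
  then have "(\<Sum>i\<in>{1..m}. \<Sum>j\<in>{1..m}. flip_sign i C * flip_sign j (flip i C) * ?T i j (flip j (flip i C))) = 0"
    by (simp add: mult.assoc flip: sum_distrib_left)
  \<comment> \<open>Mixed partials commute, so the vanishing double sum equals its transpose; the
    anticommutation lemma equates the sum of the two with -2 times the Laplacian.\<close>
  moreover have "(\<Sum>i\<in>{1..m}. \<Sum>j\<in>{1..m}. flip_sign i C * flip_sign j (flip i C) * ?T i j (flip j (flip i C))) =
      (\<Sum>i\<in>{1..m}. \<Sum>j\<in>{1..m}. flip_sign i C * flip_sign j (flip i C) * ?T j i (flip j (flip i C)))"
    by (intro sum.cong refl arg_cong2[where f="(*)"] fun_cong[OF pd_commute[OF polyfun_P]])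
  ultimately show ?thesis
    using flip_sum_anticommute[of "{1..m}" C ?T] by simp
next
  case False
  then show ?thesis
    by (simp add: P_outside)
qed

sublocale P: solid_harmonic m k "\<lambda>x. P x A" for A
  by unfold_locales (rule polyfun_P euler_P harmonic_P)+

text \<open>Since omega P = Q / r, using \<open>Q\<close> in place of omega P keeps the angular
  factor polynomial.\<close>

definition Q :: "(nat \<Rightarrow> real) \<Rightarrow> clif" where
  "Q x = cmul m (cvec m x) (P x)"

lemma Q_flip:
  "Q x C = (if C \<subseteq> {1..m} then \<Sum>j\<in>{1..m}. flip_sign j C * (x j * P x (flip j C)) else 0)"
  by (simp add: Q_def cmul_cvec_flip)

lemma Q_outside: "\<not> A \<subseteq> {1..m} \<Longrightarrow> Q x A = 0"
  by (simp add: Q_flip)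

lemma polyfun_xP: "j \<in> {1..m} \<Longrightarrow> polyfun m (\<lambda>x. x j * P x A)"
  by (intro polyfun.intros polyfun_P)

lemma polyfun_Q: "polyfun m (\<lambda>x. Q x C)"
  by (cases "C \<subseteq> {1..m}")
    (auto simp: Q_flip intro!: polyfun_sum polyfun.intros polyfun_P simp del: One_nat_def)

lemma pd_Q:
  assumes "C \<subseteq> {1..m}"
  shows "pd i (\<lambda>x. Q x C) = (\<lambda>x. \<Sum>j\<in>{1..m}. flip_sign j C *
    ((if j = i then P x (flip j C) else 0) + x j * pd i (\<lambda>x. P x (flip j C)) x))"
proof -
  have *: "pd i (\<lambda>x. flip_sign j C * (x j * P x (flip j C))) = (\<lambda>x. flip_sign j C *
    ((if j = i then P x (flip j C) else 0) + x j * pd i (\<lambda>x. P x (flip j C)) x))"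
    if "j \<in> {1..m}" for j
    using that
    by (subst pd_cmult[OF polyfun_xP]) (auto simp: pd_mult[OF polyfun.coord polyfun_P])
  have "pd i (\<lambda>x. Q x C) = pd i (\<lambda>x. \<Sum>j\<in>{1..m}. flip_sign j C * (x j * P x (flip j C)))"
    using assms by (simp add: Q_flip)
  also have "\<dots> = (\<lambda>x. \<Sum>j\<in>{1..m}. pd i (\<lambda>x. flip_sign j C * (x j * P x (flip j C))) x)"
    by (intro pd_sum[of _ m] polyfun.mult polyfun.const polyfun.coord polyfun_P)
  finally show ?thesis
    using * by simp
qed

lemma euler_Q: "(\<Sum>i\<in>{1..m}. x i * pd i (\<lambda>x. Q x C) x) = real (Suc k) * Q x C"
proof (cases "C \<subseteq> {1..m}")
  case True
  have "(\<Sum>i\<in>{1..m}. x i * pd i (\<lambda>x. Q x C) x) = (\<Sum>j\<in>{1..m}. \<Sum>i\<in>{1..m}. flip_sign j C *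
      ((if j = i then x i * P x (flip j C) else 0) + x j * (x i * pd i (\<lambda>x. P x (flip j C)) x)))"
    unfolding pd_Q[OF True] sum_distrib_left
    by (subst sum.swap) (intro sum.cong refl, simp add: algebra_simps)
  also have "\<dots> = (\<Sum>j\<in>{1..m}. flip_sign j C *
      (x j * P x (flip j C) + x j * (real k * P x (flip j C))))"
    by (simp add: sum.distrib flip: sum_distrib_left euler_P)
  also have "\<dots> = real (Suc k) * Q x C"
    using True by (simp add: Q_flip sum_distrib_left algebra_simps)
  finally show ?thesis .
next
  case False
  then show ?thesis
    by (simp add: Q_outside)
qed

text \<open>The Laplacian of x_j p is 2 d_j p plus x_j times the Laplacian of p. Multiplied by e_j
  and summed, this leaves twice the Dirac operator on \<open>P\<close>, which vanishes.\<close>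

lemma harmonic_Q: "(\<Sum>i\<in>{1..m}. pd i (pd i (\<lambda>x. Q x C)) x) = 0"
proof (cases "C \<subseteq> {1..m}")
  case True
  let ?p = "\<lambda>j x. P x (flip j C)"
  have second: "pd i (pd i (\<lambda>x. x j * ?p j x)) x =
     (if j = i then 2 * pd j (?p j) x else 0) + x j * pd i (pd i (?p j)) x"
    if "j \<in> {1..m}" for i j
  proof -
    have "pd i (\<lambda>x. x j * ?p j x) = (\<lambda>x. (if j = i then 1 else 0) * ?p j x + x j * pd i (?p j) x)"
      using that by (simp add: pd_mult[OF polyfun.coord polyfun_P])
    then show ?thesis
      using that
      by (simp add: pd_add[of m] pd_mult[of m] polyfun.intros polyfun_P polyfun_pd)
  qed
  have "(\<Sum>i\<in>{1..m}. pd i (pd i (\<lambda>x. Q x C)) x) =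
      (\<Sum>i\<in>{1..m}. \<Sum>j\<in>{1..m}. flip_sign j C * pd i (pd i (\<lambda>x. x j * ?p j x)) x)"
  proof (intro sum.cong refl)
    fix i
    have "pd i (pd i (\<lambda>x. Q x C)) = pd i (pd i (\<lambda>x. \<Sum>j\<in>{1..m}. flip_sign j C * (x j * ?p j x)))"
      using True by (simp add: Q_flip)
    also have "\<dots> = pd i (\<lambda>x. \<Sum>j\<in>{1..m}. flip_sign j C * pd i (\<lambda>x. x j * ?p j x) x)"
      by (subst pd_sum[of _ m])
        (simp_all add: pd_cmult[of m] polyfun.const polyfun.mult polyfun_xP del: One_nat_def)
    also have "\<dots> = (\<lambda>x. \<Sum>j\<in>{1..m}. flip_sign j C * pd i (pd i (\<lambda>x. x j * ?p j x)) x)"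
      by (subst pd_sum[of _ m])
        (simp_all add: pd_cmult[of m] polyfun.const polyfun.mult polyfun_xP polyfun_pd del: One_nat_def)
    finally show "pd i (pd i (\<lambda>x. Q x C)) x = (\<Sum>j\<in>{1..m}. flip_sign j C * pd i (pd i (\<lambda>x. x j * ?p j x)) x)"
      by simp
  qed
  also have "\<dots> = (\<Sum>j\<in>{1..m}. flip_sign j C * (\<Sum>i\<in>{1..m}. pd i (pd i (\<lambda>x. x j * ?p j x)) x))"
    by (subst sum.swap) (simp add: sum_distrib_left)
  also have "\<dots> = (\<Sum>j\<in>{1..m}. flip_sign j C * (2 * pd j (?p j) x))"
  proof (intro sum.cong refl)
    fix j assume "j \<in> {1..m}"
    then show "flip_sign j C * (\<Sum>i\<in>{1..m}. pd i (pd i (\<lambda>x. x j * ?p j x)) x) =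
        flip_sign j C * (2 * pd j (?p j) x)"
      using harmonic_P[of "flip j C" x]
      by (simp add: second sum.distrib flip: sum_distrib_left del: One_nat_def)
  qed
  also have "\<dots> = 2 * (\<Sum>j\<in>{1..m}. flip_sign j C * pd j (?p j) x)"
    by (simp add: sum_distrib_left mult_ac)
  finally show ?thesis
    using monogenic_flip[OF True] by simp
next
  case False
  then show ?thesis
    by (simp add: Q_outside)
qed

sublocale Q: solid_harmonic m "Suc k" "\<lambda>x. Q x A" for A
  by unfold_locales (rule polyfun_Q euler_Q harmonic_Q)+

text \<open>Anticommutation for the array d_i (x_j P) shows that the Dirac operator on
  \<open>Q\<close> plus the transposed sum is -2 (m + k) P, and the transposed sum is -m P.\<close>

lemma dirac_Q: "dirac m Q x C = - real (m + 2 * k) * P x C"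
proof (cases "C \<subseteq> {1..m}")
  case True
  let ?T = "\<lambda>i j A. (if j = i then P x A else 0) + x j * pd i (\<lambda>x. P x A) x"
  let ?S = "\<lambda>T. \<Sum>i\<in>{1..m}. \<Sum>j\<in>{1..m}. flip_sign i C * flip_sign j (flip i C) * T i j (flip j (flip i C))"
  have "dirac m Q x C = ?S ?T"
    using True by (simp add: dirac_flip pd_Q flip_subset sum_distrib_left mult_ac del: One_nat_def)
  \<comment> \<open>The transposed sum has the terms e_i e_j d_j (x_i P): where x_i is
    differentiated they give e_i e_i P = -P, and the rest contains the Dirac operator applied to
    \<open>P\<close>.\<close>
  moreover have "?S (\<lambda>i j. ?T j i) = - real m * P x C"
  proof -
    have "(\<Sum>j\<in>{1..m}. flip_sign i C * flip_sign j (flip i C) * ?T j i (flip j (flip i C))) = - P x C"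
      if "i \<in> {1..m}" for i
    proof -
      have "(\<Sum>j\<in>{1..m}. flip_sign i C * flip_sign j (flip i C) * ?T j i (flip j (flip i C))) =
        (\<Sum>j\<in>{1..m}. if j = i then flip_sign i C * flip_sign i (flip i C) * P x C else 0) +
        flip_sign i C * x i * (\<Sum>j\<in>{1..m}. flip_sign j (flip i C) * pd j (\<lambda>x. P x (flip j (flip i C))) x)"
        unfolding sum_distrib_left sum.distrib[symmetric]
        by (intro sum.cong refl) (simp add: algebra_simps)
      then show ?thesis
        using that True by (simp add: monogenic_flip flip_subset flip_sign_flip_same del: One_nat_def)
    qed
    then show ?thesis
      by simp
  qed
  moreover have "(\<Sum>i\<in>{1..m}. ?T i i C) = real m * P x C + real k * P x C"
    by (simp add: sum.distrib flip: euler_P)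
  ultimately show ?thesis
    using flip_sum_anticommute[of "{1..m}" C ?T] by (simp add: algebra_simps)
next
  case False
  then show ?thesis
    by (simp add: dirac_flip P_outside)
qed

end

subsection \<open>Functions of \<open>t\<close> and \<open>r\<close>\<close>

definition dt :: "(real \<Rightarrow> real \<Rightarrow> real) \<Rightarrow> real \<Rightarrow> real \<Rightarrow> real" where
  "dt g = (\<lambda>t r. deriv (\<lambda>t. g t r) t)"

definition dr :: "(real \<Rightarrow> real \<Rightarrow> real) \<Rightarrow> real \<Rightarrow> real \<Rightarrow> real" where
  "dr g = (\<lambda>t r. deriv (g t) r)"

definition dop :: "(real \<Rightarrow> real \<Rightarrow> real) \<Rightarrow> real \<Rightarrow> real \<Rightarrow> real" where
  "dop g = (\<lambda>t r. dr g t r / r)"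

lemma dr_eqI: "(g t has_real_derivative d) (at r) \<Longrightarrow> dr g t r = d"
  by (simp add: dr_def DERIV_imp_deriv)

lemma dt_eqI: "((\<lambda>t. g t r) has_real_derivative d) (at t) \<Longrightarrow> dt g t r = d"
  by (simp add: dt_def DERIV_imp_deriv)

lemma eventually_eq_pos:
  "(\<And>r. r > 0 \<Longrightarrow> f r = g r) \<Longrightarrow> r > 0 \<Longrightarrow> eventually (\<lambda>r. f r = g r) (nhds (r::real))"
  using eventually_nhds_in_open[of "{0<..}" r] by (auto elim: eventually_mono)

lemma has_derivative_cong_pos:
  assumes "(f has_real_derivative d) (at r)" "\<And>r. r > 0 \<Longrightarrow> f r = g r" "r > 0"
  shows "(g has_real_derivative d) (at r)"
  using assms DERIV_cong_ev[OF refl eventually_eq_pos refl] by blast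

lemma dr_cong: "(\<And>r. r > 0 \<Longrightarrow> g t r = g' t r) \<Longrightarrow> r > 0 \<Longrightarrow> dr g t r = dr g' t r"
  unfolding dr_def by (intro deriv_cong_ev eventually_eq_pos) auto

lemma dt_cong: "(\<And>t. g t r = g' t r) \<Longrightarrow> dt g t r = dt g' t r"
  by (simp add: dt_def)

text \<open>Every function that the proof differentiates is, for \<open>r > 0\<close>, a sum of real parts of
  entire functions of \<open>t + \<i> r\<close> divided by powers of \<open>r\<close>; this class is stable under the
  partial derivatives, and its members are entire in \<open>t\<close>.\<close>
inductive upper :: "(real \<Rightarrow> real \<Rightarrow> real) \<Rightarrow> bool" where
  base: "H holomorphic_on UNIV \<Longrightarrow> upper (\<lambda>t r. Re (H (Complex t r)) / r ^ a)"
| add: "upper g \<Longrightarrow> upper g' \<Longrightarrow> upper (\<lambda>t r. g t r + g' t r)"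
| cong: "upper g \<Longrightarrow> (\<And>t r. r > 0 \<Longrightarrow> g t r = g' t r) \<Longrightarrow> upper g'"

section \<open>Stability of the class \<open>upper\<close> under differentiation\<close>

lemma has_derivative_Re_t:
  assumes "H holomorphic_on UNIV"
  shows "((\<lambda>t. Re (H (Complex t r))) has_real_derivative Re (deriv H (Complex t r))) (at t)"
proof -
  have "((\<lambda>t. Complex t r) has_vector_derivative 1) (at t)"
    unfolding Complex_eq has_vector_derivative_def
    by (auto intro!: derivative_eq_intros simp: scaleR_conv_of_real)
  moreover have "(H has_field_derivative deriv H (Complex t r)) (at (Complex t r))"
    using assms by (intro holomorphic_derivI[of _ UNIV]) auto
  ultimately have "((H \<circ> (\<lambda>t. Complex t r)) has_vector_derivative 1 * deriv H (Complex t r)) (at t)"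
    by (rule field_vector_diff_chain_at)
  from bounded_linear.has_vector_derivative[OF bounded_linear_Re this] show ?thesis
    by (simp add: o_def has_real_derivative_iff_has_vector_derivative)
qed

lemma has_derivative_Re_r:
  assumes "H holomorphic_on UNIV"
  shows "((\<lambda>r. Re (H (Complex t r))) has_real_derivative Re (\<i> * deriv H (Complex t r))) (at r)"
proof -
  have "((\<lambda>r. Complex t r) has_vector_derivative \<i>) (at r)"
    unfolding Complex_eq has_vector_derivative_def
    by (auto intro!: derivative_eq_intros simp: scaleR_conv_of_real)
  moreover have "(H has_field_derivative deriv H (Complex t r)) (at (Complex t r))"
    using assms by (intro holomorphic_derivI[of _ UNIV]) auto
  ultimately have "((H \<circ> (\<lambda>r. Complex t r)) has_vector_derivative \<i> * deriv H (Complex t r)) (at r)"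
    by (rule field_vector_diff_chain_at)
  from bounded_linear.has_vector_derivative[OF bounded_linear_Re this] show ?thesis
    by (simp add: o_def has_real_derivative_iff_has_vector_derivative)
qed

lemma has_derivative_base_t:
  assumes "H holomorphic_on UNIV"
  shows "((\<lambda>t. Re (H (Complex t r)) / r ^ a) has_real_derivative Re (deriv H (Complex t r)) / r ^ a) (at t)"
  using DERIV_cdivide[OF has_derivative_Re_t[OF assms]] .

text \<open>The derivative is written as two quotients of the generating form, over
  \<open>r ^ a\<close> and \<open>r ^ Suc a\<close>, so that \<open>upper\<close> is seen to be
  closed under it.\<close>

lemma has_derivative_base_r:
  assumes "H holomorphic_on UNIV" "r > 0"
  shows "((\<lambda>r. Re (H (Complex t r)) / r ^ a) has_real_derivative
    Re (\<i> * deriv H (Complex t r)) / r ^ a + Re (- of_nat a * H (Complex t r)) / r ^ Suc a) (at r)"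
proof -
  have "((\<lambda>r. Re (H (Complex t r)) / r ^ a) has_real_derivative
    (Re (\<i> * deriv H (Complex t r)) * r ^ a - Re (H (Complex t r)) * (real a * r ^ (a - 1)))
       / (r ^ a * r ^ a)) (at r)"
    using assms(2) by (intro DERIV_divide has_derivative_Re_r assms) (auto intro!: derivative_eq_intros)
  moreover have "(Re (\<i> * deriv H (Complex t r)) * r ^ a - Re (H (Complex t r)) * (real a * r ^ (a - 1)))
       / (r ^ a * r ^ a) = Re (\<i> * deriv H (Complex t r)) / r ^ a + Re (- of_nat a * H (Complex t r)) / r ^ Suc a"
    using assms(2) by (cases a) (simp_all add: field_simps)
  ultimately show ?thesis
    by simp
qed

lemma holomorphic_deriv_UNIV: "H holomorphic_on UNIV \<Longrightarrow> deriv H holomorphic_on UNIV"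
  by (rule holomorphic_deriv) auto

text \<open>The derivatives are given by witnesses valid for \<open>r > 0\<close>, since the rule
  \<open>cong\<close> puts no condition on \<open>g\<close> elsewhere. The same rule later carries
  membership over to \<open>dt g\<close> and \<open>dr g\<close>.\<close>

lemma upper_derivs:
  assumes "upper g"
  shows "\<exists>gt gr. upper gt \<and> upper gr \<and> (\<forall>t r. r > 0 \<longrightarrow>
    ((\<lambda>t. g t r) has_real_derivative gt t r) (at t) \<and> (g t has_real_derivative gr t r) (at r))"
  using assms
proof induction
  case (base H a)
  let ?gr = "\<lambda>t r. Re (\<i> * deriv H (Complex t r)) / r ^ a + Re (- of_nat a * H (Complex t r)) / r ^ Suc a"
  have "upper (\<lambda>t r. Re (deriv H (Complex t r)) / r ^ a)"
    by (intro upper.base holomorphic_deriv_UNIV base)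
  moreover have "upper ?gr"
    by (intro upper.add upper.base[of "\<lambda>z. \<i> * deriv H z"] upper.base[of "\<lambda>z. - of_nat a * H z"]
        holomorphic_intros holomorphic_deriv_UNIV base)
  ultimately show ?case
    using has_derivative_base_t[OF base] has_derivative_base_r[OF base] by blast
next
  case (add g g')
  then obtain gt gr gt' gr' where "upper gt" "upper gr" "upper gt'" "upper gr'"
    and d: "\<And>t r. r > 0 \<Longrightarrow> ((\<lambda>t. g t r) has_real_derivative gt t r) (at t)"
    "\<And>t r. r > 0 \<Longrightarrow> (g t has_real_derivative gr t r) (at r)"
    "\<And>t r. r > 0 \<Longrightarrow> ((\<lambda>t. g' t r) has_real_derivative gt' t r) (at t)"
    "\<And>t r. r > 0 \<Longrightarrow> (g' t has_real_derivative gr' t r) (at r)"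
    by metis
  show ?case
    by (rule exI[of _ "\<lambda>t r. gt t r + gt' t r"], rule exI[of _ "\<lambda>t r. gr t r + gr' t r"])
      (auto intro!: upper.add DERIV_add d \<open>upper gt\<close> \<open>upper gr\<close> \<open>upper gt'\<close> \<open>upper gr'\<close>)
next
  case (cong g g')
  then obtain gt gr where *: "upper gt" "upper gr"
    and d: "\<And>t r. r > 0 \<Longrightarrow> ((\<lambda>t. g t r) has_real_derivative gt t r) (at t)"
    "\<And>t r. r > 0 \<Longrightarrow> (g t has_real_derivative gr t r) (at r)"
    by metis
  have "((\<lambda>t. g' t r) has_real_derivative gt t r) (at t)" if "r > 0" for t r
    using d(1)[OF that] cong.hyps(2)[OF that] by simp
  moreover have "(g' t has_real_derivative gr t r) (at r)" if "r > 0" for t r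
    by (rule has_derivative_cong_pos[OF d(2)[OF that] cong.hyps(2) that])
  ultimately show ?case
    using * by blast
qed

lemma has_dt: "upper g \<Longrightarrow> r > 0 \<Longrightarrow> ((\<lambda>t. g t r) has_real_derivative dt g t r) (at t)"
  using upper_derivs[of g] dt_eqI by metis

lemma has_dr: "upper g \<Longrightarrow> r > 0 \<Longrightarrow> (g t has_real_derivative dr g t r) (at r)"
  using upper_derivs[of g] dr_eqI by metis

lemma upper_dt: "upper g \<Longrightarrow> upper (dt g)"
  using upper_derivs[of g] dt_eqI by (metis upper.cong)

lemma upper_dr: "upper g \<Longrightarrow> upper (dr g)"
  using upper_derivs[of g] dr_eqI by (metis upper.cong)

lemma upper_divide: "upper g \<Longrightarrow> upper (\<lambda>t r. g t r / r)"
proof (induction rule: upper.induct)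
  case (base H a)
  then show ?case
    using upper.base[of H "Suc a"] by (simp add: mult.commute)
next
  case (add g g')
  then show ?case
    using upper.add by (simp add: add_divide_distrib)
next
  case (cong g g')
  then show ?case
    by (intro upper.cong[OF cong.IH]) simp
qed

lemma upper_dop: "upper g \<Longrightarrow> upper (dop g)"
  unfolding dop_def by (intro upper_divide upper_dr)

lemma upper_dop_funpow: "upper g \<Longrightarrow> upper ((dop ^^ n) g)"
  by (induction n) (simp_all add: upper_dop)

lemma upper_dt_funpow: "upper g \<Longrightarrow> upper ((dt ^^ n) g)"
  by (induction n) (simp_all add: upper_dt)

lemma dt_add:
  "upper g \<Longrightarrow> upper g' \<Longrightarrow> r > 0 \<Longrightarrow> dt (\<lambda>t r. g t r + g' t r) t r = dt g t r + dt g' t r"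
  by (intro dt_eqI DERIV_add has_dt)

lemma dr_add:
  "upper g \<Longrightarrow> upper g' \<Longrightarrow> r > 0 \<Longrightarrow> dr (\<lambda>t r. g t r + g' t r) t r = dr g t r + dr g' t r"
  by (intro dr_eqI DERIV_add has_dr)

lemma upper_cmult: "upper g \<Longrightarrow> upper (\<lambda>t r. a * g t r)"
proof (induction rule: upper.induct)
  case (base H n)
  have "upper (\<lambda>t r. Re (complex_of_real a * H (Complex t r)) / r ^ n)"
    by (intro upper.base holomorphic_intros base)
  then show ?case
    by simp
next
  case (add g g')
  then show ?case
    using upper.add by (simp add: distrib_left)
next
  case (cong g g')
  then show ?case
    by (intro upper.cong[OF cong.IH]) simp
qed

lemma dt_cmult: "upper g \<Longrightarrow> r > 0 \<Longrightarrow> dt (\<lambda>t r. a * g t r) t r = a * dt g t r"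
  by (intro dt_eqI DERIV_cmult has_dt)

lemma dr_cmult: "upper g \<Longrightarrow> r > 0 \<Longrightarrow> dr (\<lambda>t r. a * g t r) t r = a * dr g t r"
  by (intro dr_eqI DERIV_cmult has_dr)

lemma dop_cmult: "upper g \<Longrightarrow> r > 0 \<Longrightarrow> dop (\<lambda>t r. a * g t r) t r = a * dop g t r"
  by (simp add: dop_def dr_cmult)

lemma dt_base:
  assumes "H holomorphic_on UNIV"
  shows "dt (\<lambda>t r. Re (H (Complex t r)) / r ^ a) = (\<lambda>t r. Re (deriv H (Complex t r)) / r ^ a)"
  by (intro ext dt_eqI has_derivative_base_t assms)

text \<open>On a generator \<open>dt\<close> only replaces \<open>H\<close> by
  \<open>deriv H\<close>, so both orders give the formula for the \<open>r\<close> derivative with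
  \<open>deriv H\<close> in place of \<open>H\<close>.\<close>

lemma dt_dr_commute: "upper g \<Longrightarrow> r > 0 \<Longrightarrow> dt (dr g) t r = dr (dt g) t r"
proof (induction arbitrary: t r rule: upper.induct)
  case (base H a)
  let ?gr = "\<lambda>H t r. Re (\<i> * deriv H (Complex t r)) / r ^ a + Re (- of_nat a * H (Complex t r)) / r ^ Suc a"
  have "dt (dr (\<lambda>t r. Re (H (Complex t r)) / r ^ a)) t r = dt (?gr H) t r"
    by (rule dt_cong, rule dr_eqI, rule has_derivative_base_r[OF base])
  also have "\<dots> = ?gr (deriv H) t r"
  proof (intro dt_eqI DERIV_add)
    have hol: "(\<lambda>z. \<i> * deriv H z) holomorphic_on UNIV" "(\<lambda>z. - of_nat a * H z) holomorphic_on UNIV"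
      by (intro holomorphic_intros holomorphic_deriv_UNIV base)+
    have "deriv (\<lambda>z. \<i> * deriv H z) = (\<lambda>z. \<i> * deriv (deriv H) z)"
      using holomorphic_deriv_UNIV[OF base(1)]
      by (intro ext deriv_cmult) (auto simp: holomorphic_on_def field_differentiable_def)
    then show "((\<lambda>t. Re (\<i> * deriv H (Complex t r)) / r ^ a) has_real_derivative
        Re (\<i> * deriv (deriv H) (Complex t r)) / r ^ a) (at t)"
      using has_derivative_base_t[OF hol(1), of r a t] by (simp only:)
    have "deriv (\<lambda>z. - of_nat a * H z) = (\<lambda>z. - of_nat a * deriv H z)"
      using base(1)
      by (intro ext deriv_cmult) (auto simp: holomorphic_on_def field_differentiable_def)
    then show "((\<lambda>t. Re (- of_nat a * H (Complex t r)) / r ^ Suc a) has_real_derivative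
        Re (- of_nat a * deriv H (Complex t r)) / r ^ Suc a) (at t)"
      using has_derivative_base_t[OF hol(2), of r "Suc a" t] by (simp only:)
  qed
  also have "\<dots> = dr (dt (\<lambda>t r. Re (H (Complex t r)) / r ^ a)) t r"
    unfolding dt_base[OF base(1)]
    by (rule dr_eqI[symmetric], rule has_derivative_base_r[OF holomorphic_deriv_UNIV[OF base(1)] base(2)])
  finally show ?case .
next
  case (add g g')
  have "dt (dr (\<lambda>t r. g t r + g' t r)) t r = dt (\<lambda>t r. dr g t r + dr g' t r) t r"
    by (intro dt_cong dr_add add)
  also have "\<dots> = dr (dt g) t r + dr (dt g') t r"
    using add by (simp add: dt_add upper_dr)
  also have "\<dots> = dr (\<lambda>t r. dt g t r + dt g' t r) t r"
    using add by (simp add: dr_add upper_dt)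
  also have "\<dots> = dr (dt (\<lambda>t r. g t r + g' t r)) t r"
    using add by (intro dr_cong) (simp_all add: dt_add)
  finally show ?case .
next
  case (cong g g')
  have "dt (dr g') t r = dt (dr g) t r"
    using cong by (intro dt_cong dr_cong) auto
  moreover have "dr (dt g') t r = dr (dt g) t r"
    using cong by (intro dt_cong dr_cong) auto
  ultimately show ?case
    using cong by simp
qed

text \<open>For a generator, iterating \<open>dt\<close> differentiates \<open>H\<close>, so the
  series is the real part of the Taylor expansion of the entire function \<open>H\<close> about i r,
  evaluated at t + i r and divided by \<open>r ^ a\<close>.\<close>

lemma upper_taylor:
  "upper g \<Longrightarrow> r > 0 \<Longrightarrow> (\<lambda>n. t ^ n / fact n * (dt ^^ n) g 0 r) sums g t r"
proof (induction rule: upper.induct)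
  case (base H a)
  have "(dt ^^ n) (\<lambda>t r. Re (H (Complex t r)) / r ^ a) =
      (\<lambda>t r. Re ((deriv ^^ n) H (Complex t r)) / r ^ a)" for n
  proof (induction n)
    case (Suc n)
    have "(deriv ^^ n) H holomorphic_on UNIV"
      using base by (intro holomorphic_higher_deriv) auto
    with Suc show ?case
      by (simp add: dt_base)
  qed simp
  moreover have "(\<lambda>n. (deriv ^^ n) H (Complex 0 r) / fact n * (Complex t r - Complex 0 r) ^ n)
      sums H (Complex t r)"
    by (rule holomorphic_power_series[where r = "\<bar>t\<bar> + 1"])
      (auto intro: holomorphic_on_subset[OF base(1)] simp: dist_norm complex_diff complex_norm)
  then have "(\<lambda>n. Re ((deriv ^^ n) H (Complex 0 r) / fact n * (Complex t r - Complex 0 r) ^ n) / r ^ a)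
      sums (Re (H (Complex t r)) / r ^ a)"
    by (intro sums_divide sums_Re)
  moreover have "Complex t r - Complex 0 r = complex_of_real t"
    by (simp add: complex_eq_iff)
  moreover have "Re (z / fact n * complex_of_real t ^ n) = t ^ n / fact n * Re z" for z n
  proof -
    have "z / fact n * complex_of_real t ^ n = complex_of_real (t ^ n / fact n) * z"
      by simp
    then show ?thesis
      by (simp only: times_complex.sel Re_complex_of_real Im_complex_of_real)
  qed
  ultimately show ?case
    by simp
next
  case (add g g')
  have "(dt ^^ n) (\<lambda>t r. g t r + g' t r) t r = (dt ^^ n) g t r + (dt ^^ n) g' t r" for n t
  proof (induction n arbitrary: t)
    case (Suc n)
    then have "dt ((dt ^^ n) (\<lambda>t r. g t r + g' t r)) t r =
        dt (\<lambda>t r. (dt ^^ n) g t r + (dt ^^ n) g' t r) t r"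
      by (intro dt_cong)
    with add show ?case
      by (simp add: dt_add upper_dt_funpow)
  qed simp
  with add show ?case
    using sums_add[OF add.IH] by (simp add: algebra_simps)
next
  case (cong g g')
  have "(dt ^^ n) g' t r = (dt ^^ n) g t r" for n t
  proof (induction n arbitrary: t)
    case (Suc n)
    then have "dt ((dt ^^ n) g') t r = dt ((dt ^^ n) g) t r"
      by (intro dt_cong)
    then show ?case
      by simp
  qed (use cong in simp)
  with cong show ?case
    by simp
qed

text \<open>The equations of Vekua type satisfied by \<open>g\<close> and \<open>w\<close> when
  \<open>(g + w x) P\<close> is monogenic; here \<open>c = 2 k + m\<close>.\<close>
definition vekua_pair :: "real \<Rightarrow> (real \<Rightarrow> real \<Rightarrow> real) \<Rightarrow> (real \<Rightarrow> real \<Rightarrow> real) \<Rightarrow> bool" where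
  "vekua_pair c g w \<longleftrightarrow> upper g \<and> upper w \<and>
     (\<forall>t r. r > 0 \<longrightarrow> dt g t r = r * dr w t r + c * w t r \<and> dt w t r = - dop g t r)"

section \<open>Closure properties and second-order consequences of the Vekua equations\<close>

lemma has_dr_radial:
  assumes "upper w" "r > 0"
  shows "((\<lambda>r. r * dr w t r + c * w t r) has_real_derivative
    dr w t r + r * dr (dr w) t r + c * dr w t r) (at r)"
  using has_dr[OF assms] has_dr[OF upper_dr[OF assms(1)] assms(2)]
  by (auto intro!: derivative_eq_intros)

lemma dr_dop:
  assumes "upper w" "r > 0"
  shows "dr (dop w) t r = dr (dr w) t r / r - dr w t r / r\<^sup>2"
  unfolding dop_def
  by (rule dr_eqI, rule DERIV_cong[OF DERIV_divide[OF has_dr[OF upper_dr[OF assms(1)] assms(2)] DERIV_ident]])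
    (use assms(2) in \<open>simp_all add: field_simps power2_eq_square\<close>)

lemma dt_dop:
  assumes "upper w" "r > 0"
  shows "dt (dop w) t r = dop (dt w) t r"
  unfolding dop_def dt_dr_commute[OF assms, symmetric]
  by (rule dt_eqI, rule DERIV_cdivide[OF has_dt[OF upper_dr[OF assms(1)] assms(2)]])

lemma dop_vekua:
  assumes "vekua_pair c g w" "r > 0"
  shows "dop (dt g) t r = (dr w t r + r * dr (dr w) t r + c * dr w t r) / r"
proof -
  have "dr (dt g) t r = dr (\<lambda>t r. r * dr w t r + c * w t r) t r"
    using assms by (intro dr_cong) (auto simp: vekua_pair_def)
  also have "\<dots> = dr w t r + r * dr (dr w) t r + c * dr w t r"
    using assms by (intro dr_eqI has_dr_radial) (auto simp: vekua_pair_def)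
  finally show ?thesis
    by (simp add: dop_def)
qed

text \<open>Applying \<open>dop\<close> to g_t = r w_r + c w gives w_rr + (c + 1) w_r / r, whereas r
  times the r-derivative of w_r / r is w_rr - w_r / r; the difference is (c + 2) w_r / r.\<close>

lemma vekua_pair_dop:
  assumes "vekua_pair c g w"
  shows "vekua_pair (c + 2) (dop g) (dop w)"
proof -
  have upper: "upper g" "upper w"
    using assms by (auto simp: vekua_pair_def)
  have "dt (dop g) t r = r * dr (dop w) t r + (c + 2) * dop w t r" if "r > 0" for t r
    unfolding dt_dop[OF upper(1) that] dop_vekua[OF assms that] dr_dop[OF upper(2) that]
    using that by (simp add: dop_def field_simps power2_eq_square)
  moreover have "dt (dop w) t r = - dop (dop g) t r" if "r > 0" for t r
  proof -
    have "dr (dt w) t r = dr (\<lambda>t r. - dop g t r) t r"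
      using assms that by (intro dr_cong) (auto simp: vekua_pair_def)
    also have "\<dots> = - dr (dop g) t r"
      by (intro dr_eqI DERIV_minus has_dr upper_dop upper that)
    finally show ?thesis
      by (simp add: dt_dop[OF upper(2) that]) (simp add: dop_def)
  qed
  ultimately show ?thesis
    by (simp add: vekua_pair_def upper_dop upper)
qed

lemma vekua_pair_dt:
  assumes "vekua_pair c g w"
  shows "vekua_pair c (dt g) (dt w)"
proof -
  have upper: "upper g" "upper w"
    using assms by (auto simp: vekua_pair_def)
  have "dt (dt g) t r = r * dr (dt w) t r + c * dt w t r" if "r > 0" for t r
  proof -
    have "dt (dt g) t r = dt (\<lambda>t r. r * dr w t r + c * w t r) t r"
      using assms that by (intro dt_cong) (auto simp: vekua_pair_def)
    also have "\<dots> = r * dt (dr w) t r + c * dt w t r"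
      by (intro dt_eqI DERIV_add DERIV_cmult has_dt upper_dr upper that)
    finally show ?thesis
      by (simp add: dt_dr_commute upper that)
  qed
  moreover have "dt (dt w) t r = - dop (dt g) t r" if "r > 0" for t r
  proof -
    have "dt (dt w) t r = dt (\<lambda>t r. - dop g t r) t r"
      using assms that by (intro dt_cong) (auto simp: vekua_pair_def)
    also have "\<dots> = - dt (dop g) t r"
      by (intro dt_eqI DERIV_minus has_dt upper_dop upper that)
    finally show ?thesis
      by (simp add: dt_dop[OF upper(1) that])
  qed
  ultimately show ?thesis
    by (simp add: vekua_pair_def upper_dt upper)
qed

text \<open>Eliminating the other function yields separate second-order equations for
  \<open>g\<close> and \<open>w\<close>. They are solved for the \<open>t\<close> derivatives so
  that the terms with r^2 cancel in the Laplacian.\<close>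

lemma vekua_pair_wave:
  assumes "vekua_pair c g w" "r > 0"
  shows "dt (dt g) t r = - r\<^sup>2 * dop (dop g) t r - c * dop g t r"
    and "dt (dt w) t r = - r\<^sup>2 * dop (dop w) t r - (c + 2) * dop w t r"
proof -
  have upper: "upper g" "upper w"
    using assms by (auto simp: vekua_pair_def)
  have *: "dt (dt g) t r = r * dr (dt w) t r + c * dt w t r" "dt (dt w) t r = - dop (dt g) t r"
    using vekua_pair_dt[OF assms(1)] assms(2) by (auto simp: vekua_pair_def)
  have "dr (dt w) t r = r * dop (dt w) t r"
    using assms(2) by (simp add: dop_def)
  \<comment> \<open>This is the second equation of the pair \<open>dop g\<close>,
    \<open>dop w\<close>, after exchanging \<open>dop\<close> with \<open>dt\<close>.\<close>
  also have "\<dots> = r * (- dop (dop g) t r)"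
    using vekua_pair_dop[OF assms(1)] assms(2) by (auto simp: vekua_pair_def dt_dop[OF upper(2) assms(2), symmetric])
  finally show "dt (dt g) t r = - r\<^sup>2 * dop (dop g) t r - c * dop g t r"
    using assms by (simp add: * vekua_pair_def power2_eq_square)
  show "dt (dt w) t r = - r\<^sup>2 * dop (dop w) t r - (c + 2) * dop w t r"
    unfolding * dop_vekua[OF assms] using assms(2)
    by (subst (1) dop_def) (simp add: dr_dop[OF upper(2)], simp add: dop_def field_simps power2_eq_square)
qed

lemma vekua_pair_cmult:
  "vekua_pair c g w \<Longrightarrow> vekua_pair c (\<lambda>t r. a * g t r) (\<lambda>t r. a * w t r)"
  by (simp add: vekua_pair_def upper_cmult dt_cmult dr_cmult dop_cmult algebra_simps)

lemma vekua_pair_dop_funpow: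
  "vekua_pair c g w \<Longrightarrow> vekua_pair (c + 2 * real n) ((dop ^^ n) g) ((dop ^^ n) w)"
proof (induction n)
  case (Suc n)
  then show ?case
    using vekua_pair_dop[of "c + 2 * real n"] by (simp add: algebra_simps)
qed simp

lemma vekua_pair_dt_funpow: "vekua_pair c g w \<Longrightarrow> vekua_pair c ((dt ^^ n) g) ((dt ^^ n) w)"
  by (induction n) (simp_all add: vekua_pair_dt)

text \<open>With v = r w the Cauchy--Riemann equation u_t = v_r reads u_t = r w_r + w, the first
  equation for \<open>c = 1\<close>; v_t = -u_r gives the second.\<close>

lemma vekua_pair_holomorphic:
  assumes "H holomorphic_on UNIV"
  shows "vekua_pair 1 (\<lambda>t r. Re (H (Complex t r))) (\<lambda>t r. Im (H (Complex t r)) / r)"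
proof -
  \<comment> \<open>Re (-i H) = Im H brings v / r into the generating form of
    \<open>upper\<close>.\<close>
  let ?K = "\<lambda>z. - (\<i> * H z)"
  have K: "?K holomorphic_on UNIV"
    by (intro holomorphic_intros assms)
  have dK: "deriv ?K z = - (\<i> * deriv H z)" for z
    using assms by (intro DERIV_imp_deriv DERIV_minus DERIV_cmult holomorphic_derivI[of _ UNIV]) auto
  have u: "(\<lambda>t r. Re (H (Complex t r))) = (\<lambda>t r. Re (H (Complex t r)) / r ^ 0)"
    and w: "(\<lambda>t r. Im (H (Complex t r)) / r) = (\<lambda>t r. Re (?K (Complex t r)) / r ^ 1)"
    by simp_all
  have "dt (\<lambda>t r. Re (H (Complex t r)) / r ^ 0) t r = Re (deriv H (Complex t r))"
    "dt (\<lambda>t r. Re (?K (Complex t r)) / r ^ 1) t r = Re (deriv ?K (Complex t r)) / r ^ 1" for t r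
    by (simp_all only: dt_base[OF assms] dt_base[OF K]) simp
  moreover have "dr (\<lambda>t r. Re (H (Complex t r)) / r ^ 0) t r = Re (\<i> * deriv H (Complex t r))"
    if "r > 0" for t r
    using dr_eqI[where g = "\<lambda>t r. Re (H (Complex t r)) / r ^ 0", OF has_derivative_base_r[OF assms that, where a = 0]] by simp
  moreover have "dr (\<lambda>t r. Re (?K (Complex t r)) / r ^ 1) t r =
      Re (\<i> * deriv ?K (Complex t r)) / r + Re (- ?K (Complex t r)) / r\<^sup>2" if "r > 0" for t r
    using dr_eqI[where g = "\<lambda>t r. Re (?K (Complex t r)) / r ^ 1", OF has_derivative_base_r[OF K that, where a = 1]]
    by (simp add: power2_eq_square)
  ultimately show ?thesis
    unfolding vekua_pair_def u w dop_def
    using upper.base[OF assms, of 0] upper.base[OF K, of 1]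
    by (simp add: dK field_simps power2_eq_square)
qed

subsection \<open>Radial functions times polynomials\<close>

lemma vnorm_upd_outside: "j \<notin> {1..m} \<Longrightarrow> vnorm m (y(j := t)) = vnorm m y"
  unfolding vnorm_def by (intro arg_cong[of _ _ sqrt] sum.cong) auto

lemma has_derivative_vnorm:
  assumes "j \<in> {1..m}" "vnorm m y > 0"
  shows "((\<lambda>t. vnorm m (y(j := t))) has_real_derivative y j / vnorm m y) (at (y j))"
proof -
  let ?R = "\<Sum>i\<in>{1..m} - {j}. (y i)\<^sup>2"
  have eq: "vnorm m (y(j := t)) = sqrt (t\<^sup>2 + ?R)" for t
    unfolding vnorm_def using assms(1) by (subst sum.remove[of _ j]) (auto intro!: sum.cong)
  have "vnorm m y = sqrt ((y j)\<^sup>2 + ?R)"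
    using eq[of "y j"] by simp
  moreover from this have "(y j)\<^sup>2 + ?R > 0"
    using assms(2) by simp
  ultimately show ?thesis
    unfolding eq by (auto intro!: derivative_eq_intros simp: field_simps)
qed

text \<open>Continuity of the norm along coordinate lines; it permits differentiating identities
  that are known only for \<open>r > 0\<close>.\<close>

lemma eventually_vnorm_pos:
  assumes "vnorm m y > 0"
  shows "eventually (\<lambda>t. vnorm m (y(j := t)) > 0) (nhds (y j))"
proof (cases "j \<in> {1..m}")
  case True
  then have "isCont (\<lambda>t. vnorm m (y(j := t))) (y j)"
    using has_derivative_vnorm[OF True assms] DERIV_isCont by blast
  then have "((\<lambda>t. vnorm m (y(j := t))) \<longlongrightarrow> vnorm m (y(j := y j))) (nhds (y j))"
    by (rule isCont_tendsto_compose) (rule filterlim_ident)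
  then show ?thesis
    using assms by (intro order_tendstoD(1)) auto
next
  case False
  then show ?thesis
    using assms by (simp add: vnorm_upd_outside)
qed

lemma pd_cong_pos:
  assumes "\<And>y. vnorm m y > 0 \<Longrightarrow> f y = g y" "vnorm m y > 0"
  shows "pd j f y = pd j g y"
  unfolding pd_def
  by (intro deriv_cong_ev refl eventually_mono[OF eventually_vnorm_pos[OF assms(2)]] assms(1))

lemma dirac_cong_pos:
  assumes "\<And>y. vnorm m y > 0 \<Longrightarrow> F y = G y" "vnorm m y > 0"
  shows "dirac m F y = dirac m G y"
proof
  fix C
  have "pd j (\<lambda>x. F x A) y = pd j (\<lambda>x. G x A) y" for j A
    using assms by (intro pd_cong_pos[of m]) auto
  then show "dirac m F y C = dirac m G y C"
    by (simp add: dirac_flip)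
qed

lemma laplace_cong_pos:
  assumes "\<And>y. vnorm m y > 0 \<Longrightarrow> F y = G y" "vnorm m y > 0"
  shows "laplace m F y = laplace m G y"
proof
  fix C
  have "pd j (\<lambda>x. F x C) y = pd j (\<lambda>x. G x C) y" if "vnorm m y > 0" for j y
    by (rule pd_cong_pos[OF _ that]) (simp add: assms(1))
  then have "pd j (pd j (\<lambda>x. F x C)) y = pd j (pd j (\<lambda>x. G x C)) y" for j
    by (rule pd_cong_pos[OF _ assms(2)])
  then show "laplace m F y C = laplace m G y C"
    by (simp add: laplace_pd)
qed

lemma dirac_funpow_cong_pos:
  assumes "\<And>y. vnorm m y > 0 \<Longrightarrow> F y = G y" "vnorm m y > 0"
  shows "(dirac m ^^ n) F y = (dirac m ^^ n) G y"
  using assms(2)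
proof (induction n arbitrary: y)
  case (Suc n)
  then show ?case
    using dirac_cong_pos[of m "(dirac m ^^ n) F"] by simp
qed (use assms(1) in simp)

text \<open>\<open>pd\<close> is total because \<open>deriv\<close> is, so the sum rule needs
  differentiability as a separate predicate.\<close>

definition pdiff :: "nat \<Rightarrow> ((nat \<Rightarrow> real) \<Rightarrow> real) \<Rightarrow> (nat \<Rightarrow> real) \<Rightarrow> bool" where
  "pdiff j f y \<longleftrightarrow> ((\<lambda>t. f (y(j := t))) has_real_derivative pd j f y) (at (y j))"

lemma pdiffI: "((\<lambda>t. f (y(j := t))) has_real_derivative d) (at (y j)) \<Longrightarrow> pdiff j f y"
  unfolding pdiff_def using pd_eqI by metis

lemma pdiff_cong_pos:
  assumes "pdiff j g y" "\<And>y. vnorm m y > 0 \<Longrightarrow> f y = g y" "vnorm m y > 0"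
  shows "pdiff j f y"
proof (rule pdiffI)
  have "eventually (\<lambda>t. g (y(j := t)) = f (y(j := t))) (nhds (y j))"
    by (intro eventually_mono[OF eventually_vnorm_pos[OF assms(3)]]) (simp add: assms(2))
  from DERIV_cong_ev[OF refl this refl]
  show "((\<lambda>t. f (y(j := t))) has_real_derivative pd j g y) (at (y j))"
    using assms(1) unfolding pdiff_def by blast
qed

lemma pd_add_pdiff:
  assumes "pdiff j f y" "pdiff j g y"
  shows "pd j (\<lambda>x. f x + g x) y = pd j f y + pd j g y"
    and "pdiff j (\<lambda>x. f x + g x) y"
proof -
  have D: "((\<lambda>t. f (y(j := t)) + g (y(j := t))) has_real_derivative pd j f y + pd j g y) (at (y j))"
    using assms unfolding pdiff_def by (rule DERIV_add)
  show "pd j (\<lambda>x. f x + g x) y = pd j f y + pd j g y"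
    by (rule pd_eqI) (rule D)
  show "pdiff j (\<lambda>x. f x + g x) y"
    by (rule pdiffI) (rule D)
qed

text \<open>The time \<open>\<tau>\<close> is \<open>y 0\<close> in the Fueter map and the constant 0 in the coefficients
  of the Cauchy--Kowalevski series.\<close>
definition rad :: "nat \<Rightarrow> ((nat \<Rightarrow> real) \<Rightarrow> real) \<Rightarrow> (real \<Rightarrow> real \<Rightarrow> real) \<Rightarrow> (nat \<Rightarrow> real) \<Rightarrow> real" where
  "rad m \<tau> g y = g (\<tau> y) (vnorm m y)"

text \<open>As the derivative of r in x_j is x_j / r, the radial factor contributes
  \<open>dop g\<close> times \<open>y j\<close>. The result is again made of radial functions times
  polynomials, so the rule can be iterated.\<close>

lemma rad_partial:
  assumes "upper g" "polyfun m f" "j \<in> {1..m}" "\<And>y t. \<tau> (y(j := t)) = \<tau> y" "vnorm m y > 0"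
  shows "pd j (\<lambda>y. rad m \<tau> g y * f y) y = rad m \<tau> (dop g) y * (y j * f y) + rad m \<tau> g y * pd j f y"
    and "pdiff j (\<lambda>y. rad m \<tau> g y * f y) y"
proof -
  have "(g (\<tau> y) has_real_derivative dr g (\<tau> y) (vnorm m y)) (at (vnorm m (y(j := y j))))"
    using has_dr[OF assms(1,5)] by simp
  then have "((\<lambda>t. g (\<tau> y) (vnorm m (y(j := t)))) has_real_derivative
      dr g (\<tau> y) (vnorm m y) * (y j / vnorm m y)) (at (y j))"
    by (rule DERIV_chain2[where g = "\<lambda>t. vnorm m (y(j := t))"]) (rule has_derivative_vnorm[OF assms(3,5)])
  from DERIV_mult[OF this polyfun_differentiable[OF assms(2), of y j]]
  have D: "((\<lambda>t. rad m \<tau> g (y(j := t)) * f (y(j := t))) has_real_derivative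
      rad m \<tau> (dop g) y * (y j * f y) + rad m \<tau> g y * pd j f y) (at (y j))"
    by (simp add: rad_def assms(4) dop_def algebra_simps)
  show "pd j (\<lambda>y. rad m \<tau> g y * f y) y = rad m \<tau> (dop g) y * (y j * f y) + rad m \<tau> g y * pd j f y"
    "pdiff j (\<lambda>y. rad m \<tau> g y * f y) y"
    by (rule pd_eqI, rule D, rule pdiffI, rule D)
qed

lemma rad_partial_0:
  assumes "upper g" "polyfun m f" "vnorm m y > 0"
  shows "pd 0 (\<lambda>y. rad m (\<lambda>y. y 0) g y * f y) y = rad m (\<lambda>y. y 0) (dt g) y * f y"
    and "pdiff 0 (\<lambda>y. rad m (\<lambda>y. y 0) g y * f y) y"
proof -
  have D: "((\<lambda>t. rad m (\<lambda>y. y 0) g (y(0 := t)) * f (y(0 := t))) has_real_derivative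
      rad m (\<lambda>y. y 0) (dt g) y * f y) (at (y 0))"
    unfolding rad_def polyfun_upd_0[OF assms(2)]
    using DERIV_cmult_right[OF has_dt[OF assms(1,3)]] by (simp add: vnorm_upd_outside)
  show "pd 0 (\<lambda>y. rad m (\<lambda>y. y 0) g y * f y) y = rad m (\<lambda>y. y 0) (dt g) y * f y"
    "pdiff 0 (\<lambda>y. rad m (\<lambda>y. y 0) g y * f y) y"
    by (rule pd_eqI, rule D, rule pdiffI, rule D)
qed

section \<open>The Laplacian of a radial function times a solid harmonic\<close>

context solid_harmonic
begin

lemma rad_second_partial:
  assumes "upper g" "j \<in> {1..m}" "vnorm m y > 0"
  defines "R \<equiv> \<lambda>g y. rad m (\<lambda>y. y 0) g y"
  shows "pd j (pd j (\<lambda>y. R g y * q y)) y = R (dop (dop g)) y * ((y j)\<^sup>2 * q y)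
      + R (dop g) y * (q y + 2 * (y j * pd j q y)) + R g y * pd j (pd j q) y"
    and "pdiff j (pd j (\<lambda>y. R g y * q y)) y"
proof -
  have inv: "(y(j := t)) 0 = y 0" for y :: "nat \<Rightarrow> real" and t
    using assms(2) by auto
  have poly: "polyfun m (\<lambda>y. y j * q y)" "polyfun m (pd j q)"
    by (rule polyfun.mult[OF polyfun.coord[OF assms(2)] polyfun], rule polyfun_pd[OF polyfun])
  note a = rad_partial[OF upper_dop[OF assms(1)] poly(1) assms(2), of "\<lambda>y. y 0" y, OF inv assms(3), folded R_def]
  note b = rad_partial[OF assms(1) poly(2) assms(2), of "\<lambda>y. y 0" y, OF inv assms(3), folded R_def]
  have eq: "pd j (\<lambda>y. R g y * q y) y = R (dop g) y * (y j * q y) + R g y * pd j q y"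
    if "vnorm m y > 0" for y
    unfolding R_def using assms(1,2) that polyfun inv by (intro rad_partial)
  have prod: "pd j (\<lambda>y. y j * q y) = (\<lambda>y. q y + y j * pd j q y)"
    by (simp add: pd_mult[OF polyfun.coord[OF assms(2)] polyfun])
  have "pd j (pd j (\<lambda>y. R g y * q y)) y = pd j (\<lambda>y. R (dop g) y * (y j * q y) + R g y * pd j q y) y"
    by (rule pd_cong_pos[OF eq assms(3)])
  also have "\<dots> = pd j (\<lambda>y. R (dop g) y * (y j * q y)) y + pd j (\<lambda>y. R g y * pd j q y) y"
    by (rule pd_add_pdiff(1)[OF a(2) b(2)])
  also have "\<dots> = R (dop (dop g)) y * ((y j)\<^sup>2 * q y)
      + R (dop g) y * (q y + 2 * (y j * pd j q y)) + R g y * pd j (pd j q) y"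
    unfolding a(1) b(1) prod by (simp add: algebra_simps power2_eq_square)
  finally show "pd j (pd j (\<lambda>y. R g y * q y)) y = R (dop (dop g)) y * ((y j)\<^sup>2 * q y)
      + R (dop g) y * (q y + 2 * (y j * pd j q y)) + R g y * pd j (pd j q) y" .
  show "pdiff j (pd j (\<lambda>y. R g y * q y)) y"
    by (rule pdiff_cong_pos[OF pd_add_pdiff(2)[OF a(2) b(2)] eq assms(3)])
qed

lemma rad_second_partial_0:
  assumes "upper g" "vnorm m y > 0"
  defines "R \<equiv> \<lambda>g y. rad m (\<lambda>y. y 0) g y"
  shows "pd 0 (pd 0 (\<lambda>y. R g y * q y)) y = R (dt (dt g)) y * q y"
    and "pdiff 0 (pd 0 (\<lambda>y. R g y * q y)) y"
proof -
  have eq: "pd 0 (\<lambda>y. R g y * q y) y = R (dt g) y * q y" if "vnorm m y > 0" for y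
    unfolding R_def using assms(1) polyfun that by (rule rad_partial_0)
  note a = rad_partial_0[OF upper_dt[OF assms(1)] polyfun assms(2), folded R_def]
  show "pd 0 (pd 0 (\<lambda>y. R g y * q y)) y = R (dt (dt g)) y * q y"
    using pd_cong_pos[OF eq assms(2)] a(1) by simp
  show "pdiff 0 (pd 0 (\<lambda>y. R g y * q y)) y"
    by (rule pdiff_cong_pos[OF a(2) eq assms(2)])
qed

text \<open>Harmonicity of \<open>q\<close> removes the terms with its second derivatives; in
  \<open>m + 2 * d\<close> the \<open>m\<close> counts coordinates and \<open>2 * d\<close> comes
  from Euler's identity.\<close>

lemma laplacian_rad:
  assumes "upper g" "vnorm m y > 0"
  defines "R \<equiv> \<lambda>g y. rad m (\<lambda>y. y 0) g y"
  shows "(\<Sum>j\<in>{0..m}. pd j (pd j (\<lambda>y. R g y * q y)) y) =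
    (R (dt (dt g)) y + (vnorm m y)\<^sup>2 * R (dop (dop g)) y + real (m + 2 * d) * R (dop g) y) * q y"
proof -
  have "{0..m} = insert 0 {1..m}"
    by auto
  then have "(\<Sum>j\<in>{0..m}. pd j (pd j (\<lambda>y. R g y * q y)) y) =
      R (dt (dt g)) y * q y + (\<Sum>j\<in>{1..m}. pd j (pd j (\<lambda>y. R g y * q y)) y)"
    using rad_second_partial_0(1)[OF assms(1,2)] by (simp add: R_def del: One_nat_def)
  also have "(\<Sum>j\<in>{1..m}. pd j (pd j (\<lambda>y. R g y * q y)) y) =
      (\<Sum>j\<in>{1..m}. R (dop (dop g)) y * ((y j)\<^sup>2 * q y)
        + R (dop g) y * (q y + 2 * (y j * pd j q y)) + R g y * pd j (pd j q) y)"
    unfolding R_def by (intro sum.cong refl rad_second_partial assms)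
  also have "\<dots> = R (dop (dop g)) y * ((\<Sum>j\<in>{1..m}. (y j)\<^sup>2) * q y)
      + R (dop g) y * (real m * q y + 2 * (\<Sum>j\<in>{1..m}. y j * pd j q y))
      + R g y * (\<Sum>j\<in>{1..m}. pd j (pd j q) y)"
    by (simp add: sum.distrib flip: sum_distrib_left sum_distrib_right)
  also have "(\<Sum>j\<in>{1..m}. (y j)\<^sup>2) = (vnorm m y)\<^sup>2"
    by (simp add: vnorm_def sum_nonneg)
  finally show ?thesis
    unfolding euler harmonic by (simp add: algebra_simps)
qed

end

section \<open>Laplacian, Dirac operator and Cauchy--Kowalevski series on combinations of
  \<open>P\<close> and \<open>Q\<close>\<close>

context monogenic_poly
begin

definition comb ::
  "((nat \<Rightarrow> real) \<Rightarrow> real) \<Rightarrow> (real \<Rightarrow> real \<Rightarrow> real) \<Rightarrow> (real \<Rightarrow> real \<Rightarrow> real) \<Rightarrow> (nat \<Rightarrow> real) \<Rightarrow> clif" where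
  "comb \<tau> g w y = (\<lambda>A. rad m \<tau> g y * P y A + rad m \<tau> w y * Q y A)"

lemma comb_cmult:
  "comb \<tau> (\<lambda>t r. a * g t r) (\<lambda>t r. a * w t r) y A = a * comb \<tau> g w y A"
  by (simp add: comb_def rad_def algebra_simps)

lemma comb_cong_pos:
  assumes "\<And>t r. r > 0 \<Longrightarrow> g t r = g' t r" "\<And>t r. r > 0 \<Longrightarrow> w t r = w' t r" "vnorm m y > 0"
  shows "comb \<tau> g w y = comb \<tau> g' w' y"
  by (simp add: comb_def rad_def assms)

text \<open>The second-order equations cancel the terms with r^2. There remains the factor m + 2 k -
  c at \<open>P\<close> and m + 2 (k + 1) - (c + 2) at \<open>Q\<close>, whose degree is one higher:
  the same number.\<close>

lemma laplace_comb:
  assumes "vekua_pair c g w" "vnorm m y > 0"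
  shows "laplace m (comb (\<lambda>y. y 0) g w) y C =
    (real (m + 2 * k) - c) * comb (\<lambda>y. y 0) (dop g) (dop w) y C"
proof -
  let ?R = "rad m (\<lambda>y. y 0)"
  have upper: "upper g" "upper w"
    using assms by (auto simp: vekua_pair_def)
  have "pd j (pd j (\<lambda>y. ?R g y * P y C + ?R w y * Q y C)) y =
      pd j (pd j (\<lambda>y. ?R g y * P y C)) y + pd j (pd j (\<lambda>y. ?R w y * Q y C)) y" if j: "j \<in> {0..m}" for j
  proof -
    have inv: "(y(j := t)) 0 = y 0" if "j \<noteq> 0" for y :: "nat \<Rightarrow> real" and t
      using that by simp
    have j': "j \<in> {1..m}" if "j \<noteq> 0"
      using j that by auto
    have d1: "pdiff j (\<lambda>y. ?R g y * P y C) y" "pdiff j (\<lambda>y. ?R w y * Q y C) y" if "vnorm m y > 0" for y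
    proof -
      show "pdiff j (\<lambda>y. ?R g y * P y C) y"
        by (cases "j = 0") (use that in \<open>auto intro!: rad_partial_0 rad_partial upper polyfun_P j' inv\<close>)
      show "pdiff j (\<lambda>y. ?R w y * Q y C) y"
        by (cases "j = 0") (use that in \<open>auto intro!: rad_partial_0 rad_partial upper polyfun_Q j' inv\<close>)
    qed
    have d2: "pdiff j (pd j (\<lambda>y. ?R g y * P y C)) y" "pdiff j (pd j (\<lambda>y. ?R w y * Q y C)) y"
      using P.rad_second_partial(2)[OF upper(1) j' assms(2)] Q.rad_second_partial(2)[OF upper(2) j' assms(2)]
        P.rad_second_partial_0(2)[OF upper(1) assms(2)] Q.rad_second_partial_0(2)[OF upper(2) assms(2)]
      by (cases "j = 0"; blast)+
    have "pd j (pd j (\<lambda>y. ?R g y * P y C + ?R w y * Q y C)) y =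
      pd j (\<lambda>y. pd j (\<lambda>y. ?R g y * P y C) y + pd j (\<lambda>y. ?R w y * Q y C) y) y"
      by (rule pd_cong_pos[OF pd_add_pdiff(1)[OF d1] assms(2)])
    then show ?thesis
      by (simp add: pd_add_pdiff(1)[OF d2])
  qed
  then have "laplace m (comb (\<lambda>y. y 0) g w) y C =
      (\<Sum>j\<in>{0..m}. pd j (pd j (\<lambda>y. ?R g y * P y C)) y) + (\<Sum>j\<in>{0..m}. pd j (pd j (\<lambda>y. ?R w y * Q y C)) y)"
    unfolding laplace_pd comb_def sum.distrib[symmetric] by (intro sum.cong refl)
  also have "\<dots> = (real (m + 2 * k) - c) * comb (\<lambda>y. y 0) (dop g) (dop w) y C"
    unfolding P.laplacian_rad[OF upper(1) assms(2)] Q.laplacian_rad[OF upper(2) assms(2)]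
    by (simp add: rad_def comb_def vekua_pair_wave[OF assms(1,2)] algebra_simps)
  finally show ?thesis .
qed

text \<open>Each Laplacian replaces the pair by its \<open>dop\<close> image and so raises
  \<open>c\<close> by 2; hence successive factors drop by 2.\<close>

lemma laplace_funpow_comb:
  assumes "vekua_pair c g w" "vnorm m y > 0"
  shows "(laplace m ^^ n) (comb (\<lambda>y. y 0) g w) y C =
    (\<Prod>i<n. real (m + 2 * k) - c - 2 * real i) * comb (\<lambda>y. y 0) ((dop ^^ n) g) ((dop ^^ n) w) y C"
  using assms(2)
proof (induction n arbitrary: y C)
  case (Suc n)
  let ?a = "\<Prod>i<n. real (m + 2 * k) - c - 2 * real i"
  \<comment> \<open>The scalar accumulated so far is moved into the pair, so that
    \<open>laplace_comb\<close> applies to it directly.\<close>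
  let ?g = "\<lambda>t r. ?a * (dop ^^ n) g t r" and ?w = "\<lambda>t r. ?a * (dop ^^ n) w t r"
  have vp: "vekua_pair (c + 2 * real n) ?g ?w"
    by (intro vekua_pair_cmult vekua_pair_dop_funpow assms(1))
  have upper: "upper g" "upper w"
    using assms by (auto simp: vekua_pair_def)
  have "(laplace m ^^ Suc n) (comb (\<lambda>y. y 0) g w) y C = laplace m (comb (\<lambda>y. y 0) ?g ?w) y C"
    using laplace_cong_pos[of m "(laplace m ^^ n) (comb (\<lambda>y. y 0) g w)" "comb (\<lambda>y. y 0) ?g ?w" y] Suc
    by (simp add: comb_cmult fun_eq_iff)
  also have "\<dots> = (real (m + 2 * k) - (c + 2 * real n)) * comb (\<lambda>y. y 0) (dop ?g) (dop ?w) y C"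
    by (rule laplace_comb[OF vp Suc.prems])
  also have "comb (\<lambda>y. y 0) (dop ?g) (dop ?w) y =
      comb (\<lambda>y. y 0) (\<lambda>t r. ?a * (dop ^^ Suc n) g t r) (\<lambda>t r. ?a * (dop ^^ Suc n) w t r) y"
    using Suc.prems by (intro comb_cong_pos) (simp_all add: dop_cmult upper_dop_funpow upper)
  finally show ?case
    by (simp only: comb_cmult prod.lessThan_Suc) (simp only: mult_ac diff_diff_eq)
qed simp

text \<open>By x Q = -r^2 P and the value of the Dirac operator on \<open>Q\<close>, the Vekua
  equations with c = m + 2 k turn the coefficients of \<open>P\<close> and \<open>Q\<close> into
  \<open>- dt g\<close> and \<open>- dt w\<close>. The condition on \<open>\<tau>\<close> admits
  both \<open>y 0\<close> and a constant.\<close>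

lemma dirac_comb:
  assumes "vekua_pair (real (m + 2 * k)) g w" "vnorm m y > 0"
    and \<tau>: "\<And>j y t. j \<in> {1..m} \<Longrightarrow> \<tau> (y(j := t)) = \<tau> y"
  shows "dirac m (comb \<tau> g w) y C = - comb \<tau> (dt g) (dt w) y C"
proof (cases "C \<subseteq> {1..m}")
  case True
  let ?R = "rad m \<tau>"
  have upper: "upper g" "upper w"
    using assms by (auto simp: vekua_pair_def)
  have pd: "pd j (\<lambda>y. ?R g y * P y A + ?R w y * Q y A) y =
      ?R (dop g) y * (y j * P y A) + ?R g y * pd j (\<lambda>y. P y A) y +
      (?R (dop w) y * (y j * Q y A) + ?R w y * pd j (\<lambda>y. Q y A) y)" if "j \<in> {1..m}" for j A
    using rad_partial[OF upper(1) polyfun_P that \<tau>[OF that] assms(2)]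
      rad_partial[OF upper(2) polyfun_Q that \<tau>[OF that] assms(2)]
    by (simp add: pd_add_pdiff(1))
  have "dirac m (comb \<tau> g w) y C = (\<Sum>j\<in>{1..m}. flip_sign j C *
      (?R (dop g) y * (y j * P y (flip j C)) + ?R g y * pd j (\<lambda>y. P y (flip j C)) y +
      (?R (dop w) y * (y j * Q y (flip j C)) + ?R w y * pd j (\<lambda>y. Q y (flip j C)) y)))"
    using True by (simp add: dirac_flip comb_def pd del: One_nat_def)
  also have "\<dots> = ?R (dop g) y * (\<Sum>j\<in>{1..m}. flip_sign j C * (y j * P y (flip j C)))
     + ?R g y * (\<Sum>j\<in>{1..m}. flip_sign j C * pd j (\<lambda>y. P y (flip j C)) y)
     + ?R (dop w) y * (\<Sum>j\<in>{1..m}. flip_sign j C * (y j * Q y (flip j C)))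
     + ?R w y * (\<Sum>j\<in>{1..m}. flip_sign j C * pd j (\<lambda>y. Q y (flip j C)) y)"
    unfolding sum_distrib_left sum.distrib[symmetric]
    by (intro sum.cong refl) (simp add: algebra_simps)
  also have "\<dots> = ?R (dop g) y * Q y C + ?R (dop w) y * cmul m (cvec m y) (Q y) C
      + ?R w y * dirac m Q y C"
    using True by (simp add: Q_flip[of y C] monogenic_flip cmul_cvec_flip dirac_flip del: One_nat_def)
  also have "\<dots> = ?R (dop g) y * Q y C - ((vnorm m y)\<^sup>2 * ?R (dop w) y + real (m + 2 * k) * ?R w y) * P y C"
  proof -
    have "cmul m (cvec m y) (Q y) C = - (vnorm m y)\<^sup>2 * P y C"
      unfolding Q_def by (rule cvec_mul_cvec) (rule P_outside)
    then show ?thesis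
      by (simp add: dirac_Q algebra_simps)
  qed
  also have "\<dots> = - comb \<tau> (dt g) (dt w) y C"
    using assms(1,2) by (simp add: vekua_pair_def comb_def rad_def dop_def[of w] power2_eq_square algebra_simps)
  finally show ?thesis .
next
  case False
  then show ?thesis
    by (simp add: dirac_flip comb_def P_outside Q_outside)
qed

lemma dirac_funpow_comb:
  assumes "vekua_pair (real (m + 2 * k)) g w" "vnorm m y > 0"
    and \<tau>: "\<And>j y t. j \<in> {1..m} \<Longrightarrow> \<tau> (y(j := t)) = \<tau> y"
  shows "(dirac m ^^ n) (comb \<tau> g w) y C = (-1) ^ n * comb \<tau> ((dt ^^ n) g) ((dt ^^ n) w) y C"
  using assms(2)
proof (induction n arbitrary: y C)
  case (Suc n)
  let ?g = "\<lambda>t r. (-1) ^ n * (dt ^^ n) g t r" and ?w = "\<lambda>t r. (-1) ^ n * (dt ^^ n) w t r"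
  have vp: "vekua_pair (real (m + 2 * k)) ?g ?w"
    by (intro vekua_pair_cmult vekua_pair_dt_funpow assms(1))
  have upper: "upper g" "upper w"
    using assms by (auto simp: vekua_pair_def)
  have "(dirac m ^^ Suc n) (comb \<tau> g w) y C = dirac m (comb \<tau> ?g ?w) y C"
    using dirac_cong_pos[of m "(dirac m ^^ n) (comb \<tau> g w)" "comb \<tau> ?g ?w" y] Suc
    by (simp add: comb_cmult fun_eq_iff)
  also have "\<dots> = - comb \<tau> (dt ?g) (dt ?w) y C"
    by (rule dirac_comb[OF vp Suc.prems \<tau>])
  also have "comb \<tau> (dt ?g) (dt ?w) y =
      comb \<tau> (\<lambda>t r. (-1) ^ n * (dt ^^ Suc n) g t r) (\<lambda>t r. (-1) ^ n * (dt ^^ Suc n) w t r) y"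
    using Suc.prems by (intro comb_cong_pos) (simp_all add: dt_cmult upper_dt_funpow upper)
  finally show ?case
    by (simp add: comb_cmult)
qed simp

text \<open>The sign of each Dirac power cancels that of \<open>(- y 0) ^ n\<close>, which leaves
  the Taylor series of \<open>g\<close> and \<open>w\<close> in \<open>t\<close> at 0. Agreement of
  \<open>F\<close> with the combination for \<open>r > 0\<close> suffices because the Dirac operator
  is local.\<close>

lemma CK_comb:
  assumes "vekua_pair (real (m + 2 * k)) g w" "vnorm m y > 0"
    and "\<And>x. vnorm m x > 0 \<Longrightarrow> F x = comb (\<lambda>x. 0) g w x"
  shows "CK m F y = comb (\<lambda>y. y 0) g w y"
proof
  fix A
  have upper: "upper g" "upper w"
    using assms by (auto simp: vekua_pair_def)
  let ?r = "vnorm m y"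
  have "(- y 0) ^ n / fact n * (dirac m ^^ n) F y A =
      (y 0 ^ n / fact n * (dt ^^ n) g 0 ?r) * P y A + (y 0 ^ n / fact n * (dt ^^ n) w 0 ?r) * Q y A" for n
  proof -
    have "(- y 0) ^ n / fact n * ((-1) ^ n * z) = y 0 ^ n / fact n * z" for z
    proof -
      have "(- y 0) ^ n / fact n * ((-1) ^ n * z) = (- y 0 * (-1)) ^ n / fact n * z"
        unfolding power_mult_distrib by simp
      then show ?thesis
        by simp
    qed
    moreover have "(dirac m ^^ n) F y A = (-1) ^ n * comb (\<lambda>x. 0) ((dt ^^ n) g) ((dt ^^ n) w) y A"
      by (simp add: dirac_funpow_cong_pos[OF assms(3,2)] dirac_funpow_comb[OF assms(1,2)])
    ultimately show ?thesis
      by (simp only: comb_def rad_def distrib_left mult.assoc)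
  qed
  moreover have "(\<lambda>n. (y 0 ^ n / fact n * (dt ^^ n) g 0 ?r) * P y A + (y 0 ^ n / fact n * (dt ^^ n) w 0 ?r) * Q y A)
      sums (g (y 0) ?r * P y A + w (y 0) ?r * Q y A)"
    by (intro sums_add sums_mult2 upper_taylor upper assms(2))
  ultimately show "CK m F y A = comb (\<lambda>y. y 0) g w y A"
    unfolding CK_def comb_def rad_def using sums_unique by fastforce
qed

end

subsection \<open>The operators \<open>D_r\<close> and \<open>D_up\<close>\<close>

lemma D_r_0 [simp]: "D_r 0 f = f"
  by (simp add: D_r_def)

lemma D_r_Suc: "D_r (Suc n) f s = deriv (D_r n f) s / s"
  by (simp add: D_r_def)

lemma D_up_Suc: "D_up (Suc n) f s = deriv (\<lambda>t. D_up n f t / t) s"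
  by (simp add: D_up_def)

lemma deriv_cong_pos: "(\<And>s. s > 0 \<Longrightarrow> f s = h s) \<Longrightarrow> s > 0 \<Longrightarrow> deriv f s = deriv h (s::real)"
  by (intro deriv_cong_ev eventually_eq_pos) auto

lemma D_r_zero: "D_r n (\<lambda>s. 0) = (\<lambda>s. 0)"
  by (induction n) (auto simp: D_r_Suc)

text \<open>\<open>D_up\<close> is \<open>D_r\<close> conjugated by multiplication with
  \<open>s\<close>; this reduces the sine sum to iterates of \<open>D_r\<close>.\<close>

lemma D_up_eq_D_r: "s > 0 \<Longrightarrow> D_up n f s = s * D_r n (\<lambda>s. f s / s) s"
proof (induction n arbitrary: s)
  case (Suc n)
  then have "deriv (\<lambda>t. D_up n f t / t) s = deriv (D_r n (\<lambda>s. f s / s)) s"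
    by (intro deriv_cong_pos) auto
  with Suc.prems show ?case
    by (simp add: D_up_Suc D_r_Suc)
qed (simp add: D_up_def)

lemma dop_funpow_eq_D_r: "(dop ^^ n) g t = D_r n (g t)"
  by (induction n) (auto simp: D_r_Suc dop_def dr_def)

lemma upper_D_r_has_derivative:
  "upper g \<Longrightarrow> s > 0 \<Longrightarrow> (D_r j (g t) has_real_derivative deriv (D_r j (g t)) s) (at s)"
  using has_dr[OF upper_dop_funpow, of g s j t] by (simp add: dop_funpow_eq_D_r dr_def)

text \<open>One step (1/s) d/ds multiplies the exponential by -2, so on the cofactor
  \<open>f\<close> it acts as -2 (1 - D / 2) with D = (1/s) d/ds; the \<open>n\<close>-th power
  expands binomially.\<close>

lemma D_r_exp_mult:
  assumes "\<And>j s. s > 0 \<Longrightarrow> (D_r j f has_real_derivative deriv (D_r j f) s) (at s)" "s > 0"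
  shows "D_r n (\<lambda>s. exp (c - s\<^sup>2) * f s) s =
    (-2) ^ n * (exp (c - s\<^sup>2) * (\<Sum>j\<in>{0..n}. real (n choose j) / (-2) ^ j * D_r j f s))"
  using assms(2)
proof (induction n arbitrary: s)
  case (Suc n)
  let ?T = "\<lambda>n s. \<Sum>j\<in>{0..n}. real (n choose j) / (-2) ^ j * D_r j f s"
  let ?T' = "\<Sum>j\<in>{0..n}. real (n choose j) / (-2) ^ j * deriv (D_r j f) s"
  have "((\<lambda>s. (-2) ^ n * (exp (c - s\<^sup>2) * ?T n s)) has_real_derivative
      (-2) ^ n * (exp (c - s\<^sup>2) * (- 2 * s) * ?T n s + ?T' * exp (c - s\<^sup>2))) (at s)"
    using Suc.prems
    by (intro DERIV_cmult DERIV_mult DERIV_sum assms(1)) (auto intro!: derivative_eq_intros)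
  then have "deriv (D_r n (\<lambda>s. exp (c - s\<^sup>2) * f s)) s =
      (-2) ^ n * (exp (c - s\<^sup>2) * (- 2 * s) * ?T n s + ?T' * exp (c - s\<^sup>2))"
    using deriv_cong_pos[OF Suc.IH Suc.prems] DERIV_imp_deriv by simp
  then have "D_r (Suc n) (\<lambda>s. exp (c - s\<^sup>2) * f s) s =
      (-2) ^ Suc n * (exp (c - s\<^sup>2) * (?T n s + (?T' / s) / (-2)))"
    using Suc.prems by (simp add: D_r_Suc field_simps)
  also have "?T' / s / (-2) = (\<Sum>j\<in>{0..n}. real (n choose j) / (-2) ^ Suc j * D_r (Suc j) f s)"
    unfolding sum_divide_distrib by (intro sum.cong refl) (simp add: D_r_Suc)
  also have "?T n s + \<dots> = ?T (Suc n) s"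
  proof -
    have "?T (Suc n) s = D_r 0 f s + (\<Sum>j\<in>{0..n}. real (Suc n choose Suc j) / (-2) ^ Suc j * D_r (Suc j) f s)"
      by (subst sum.atLeast0_atMost_Suc_shift) simp
    also have "\<dots> = D_r 0 f s + (\<Sum>j\<in>{0..n}. real (n choose Suc j) / (-2) ^ Suc j * D_r (Suc j) f s)
        + (\<Sum>j\<in>{0..n}. real (n choose j) / (-2) ^ Suc j * D_r (Suc j) f s)"
      by (simp only: binomial_Suc_Suc of_nat_add add_divide_distrib distrib_right sum.distrib)
    also have "D_r 0 f s + (\<Sum>j\<in>{0..n}. real (n choose Suc j) / (-2) ^ Suc j * D_r (Suc j) f s) =
        (\<Sum>j\<in>{0..Suc n}. real (n choose j) / (-2) ^ j * D_r j f s)"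
      by (subst sum.atLeast0_atMost_Suc_shift) simp
    \<comment> \<open>The top term \<open>j = Suc n\<close> vanishes, as
      \<open>n choose Suc n\<close> is 0.\<close>
    also have "\<dots> = ?T n s"
      by simp
    finally show ?thesis
      by simp
  qed
  finally show ?case .
qed simp

text \<open>The Gaussian is an eigenfunction of (1/s) d/ds with eigenvalue -2, which is the source
  of the normalisation by \<open>(-2) ^ N\<close>.\<close>

lemma D_r_gaussian:
  assumes "s > 0"
  shows "D_r n (\<lambda>s. exp (- s\<^sup>2)) s = (-2) ^ n * exp (- s\<^sup>2)"
  using assms
proof (induction n arbitrary: s)
  case (Suc n)
  have "((\<lambda>s. (-2) ^ n * exp (- s\<^sup>2)) has_real_derivative (-2) ^ n * (exp (- s\<^sup>2) * (- 2 * s))) (at s)"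
    by (auto intro!: derivative_eq_intros)
  then have "deriv (D_r n (\<lambda>s. exp (- s\<^sup>2))) s = (-2) ^ n * (exp (- s\<^sup>2) * (- 2 * s))"
    using deriv_cong_pos[OF Suc.IH Suc.prems] DERIV_imp_deriv by simp
  with Suc.prems show ?case
    by (simp add: D_r_Suc)
qed simp

lemma exp_square_Complex:
  "Re (exp ((Complex t r)\<^sup>2)) = exp (t\<^sup>2 - r\<^sup>2) * cos (2 * t * r)"
  "Im (exp ((Complex t r)\<^sup>2)) = exp (t\<^sup>2 - r\<^sup>2) * sin (2 * t * r)"
  by (simp_all add: Re_exp Im_exp power2_eq_square) (simp_all add: mult_ac)

text \<open>Membership of the cosine in \<open>upper\<close> makes all its \<open>D_r\<close>
  iterates differentiable.\<close>

lemma D_r_cos_has_derivative: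
  assumes "s > 0"
  shows "(D_r j (\<lambda>s. cos (2 * t * s)) has_real_derivative deriv (D_r j (\<lambda>s. cos (2 * t * s))) s) (at s)"
proof -
  \<comment> \<open>On the imaginary axis z = i s the argument -2 i t z is the real number 2 t s.
    Here \<open>t\<close> is a fixed parameter and \<open>x\<close> is the time variable of
    \<open>upper\<close>, to be set to 0.\<close>
  let ?g = "\<lambda>x r. Re (cos (- (2 * of_real t * \<i>) * Complex x r)) / r ^ 0"
  have "upper ?g"
    by (rule upper.base[of "\<lambda>z. cos (- (2 * of_real t * \<i>) * z)"]) (intro holomorphic_intros)
  moreover have "- (2 * of_real t * \<i>) * Complex 0 s = complex_of_real (2 * t * s)" for s
    by (simp add: complex_eq_iff)
  then have "?g 0 = (\<lambda>s. cos (2 * t * s))"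
    by (simp only: cos_of_real Re_complex_of_real) simp
  ultimately show ?thesis
    using upper_D_r_has_derivative[of ?g s j 0] assms by simp
qed

lemma D_r_sin_has_derivative:
  assumes "s > 0"
  shows "(D_r j (\<lambda>s. sin (2 * t * s) / s) has_real_derivative deriv (D_r j (\<lambda>s. sin (2 * t * s) / s)) s) (at s)"
proof -
  let ?g = "\<lambda>x r. Re (sin (- (2 * of_real t * \<i>) * Complex x r)) / r ^ 1"
  have "upper ?g"
    by (rule upper.base[of "\<lambda>z. sin (- (2 * of_real t * \<i>) * z)"]) (intro holomorphic_intros)
  moreover have "- (2 * of_real t * \<i>) * Complex 0 s = complex_of_real (2 * t * s)" for s
    by (simp add: complex_eq_iff)
  then have "?g 0 = (\<lambda>s. sin (2 * t * s) / s)"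
    by (simp only: sin_of_real Re_complex_of_real) simp
  ultimately show ?thesis
    using upper_D_r_has_derivative[of ?g s j 0] assms by simp
qed

text \<open>The right side is the product of the factors produced by \<open>n\<close> Laplacians
  when c = 1 and m + 2 k = 1 + 2 n.\<close>

lemma dfact_double: "real (dfact (2 * n)) = (\<Prod>i<n. 2 * real n - 2 * real i)"
proof (induction n)
  case (Suc n)
  have "real (dfact (2 * Suc n)) = 2 * real (Suc n) * real (dfact (2 * n))"
    by (simp add: distrib_right)
  then show ?case
    unfolding prod.lessThan_Suc_shift Suc.IH by (simp add: algebra_simps)
qed simp

theorem theorem1:
  fixes m k :: nat and P :: "(nat \<Rightarrow> real) \<Rightarrow> clif" and y :: "nat \<Rightarrow> real"
  assumes "odd m"
    and "homog_clif_poly m k P"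
    and "\<forall>x. dirac m P x = (\<lambda>A. 0)"
    and "vnorm m y > 0"
  shows "CK m (\<lambda>x. (\<lambda>A. exp (- (vnorm m x)\<^sup>2) * P x A)) y
           = (\<lambda>A. Ft m k (\<lambda>z. exp (z\<^sup>2)) P y A
                  / ((-2) ^ (k + (m - 1) div 2) * real (dfact (2 * k + m - 1))))
       \<and> CK m (\<lambda>x. (\<lambda>A. exp (- (vnorm m x)\<^sup>2) * P x A)) y
           = (\<lambda>A. exp ((y 0)\<^sup>2 - (vnorm m y)\<^sup>2) *
                cmul m (\<lambda>B. cscal (\<Sum>j\<in>{0..k + (m - 1) div 2}.
                                    real ((k + (m - 1) div 2) choose j) / (-2) ^ j
                                    * D_r j (\<lambda>s. cos (2 * y 0 * s)) (vnorm m y)) B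
                             + (\<Sum>j\<in>{0..k + (m - 1) div 2}.
                                    real ((k + (m - 1) div 2) choose j) / (-2) ^ j
                                    * D_up j (\<lambda>s. sin (2 * y 0 * s)) (vnorm m y)) * comega m y B)
                       (P y) A)"
proof -
  interpret monogenic_poly m k P
    using assms by unfold_locales auto
  define N where "N = k + (m - 1) div 2"
  define u where "u = (\<lambda>t r. Re (exp ((Complex t r)\<^sup>2)))"
  define w where "w = (\<lambda>t r. Im (exp ((Complex t r)\<^sup>2)) / r)"
  \<comment> \<open>The factor \<open>1 / (-2) ^ N\<close> makes \<open>g\<close> the Gaussian at
    \<open>t = 0\<close>, for \<open>r > 0\<close>.\<close>
  define g where "g = (\<lambda>t r. 1 / (-2) ^ N * (dop ^^ N) u t r)"
  define h where "h = (\<lambda>t r. 1 / (-2) ^ N * (dop ^^ N) w t r)"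
  let ?F = "\<lambda>x A. exp (- (vnorm m x)\<^sup>2) * P x A" and ?r = "vnorm m y"
  \<comment> \<open>Oddness of \<open>m\<close> makes the halving exact, so \<open>N\<close>
    applications of \<open>dop\<close> lead from \<open>c = 1\<close> to the value m + 2 k required
    for monogenicity.\<close>
  have N: "2 * k + m - 1 = 2 * N" "real (m + 2 * k) = 1 + 2 * real N"
    using assms(1) by (auto elim!: oddE simp: N_def)
  have vp: "vekua_pair 1 u w"
    unfolding u_def w_def by (rule vekua_pair_holomorphic) (intro holomorphic_intros)
  have CK: "CK m ?F y = comb (\<lambda>y. y 0) g h y"
  proof (rule CK_comb[OF _ assms(4)])
    show "vekua_pair (real (m + 2 * k)) g h"
      unfolding g_def h_def N(2) by (intro vekua_pair_cmult vekua_pair_dop_funpow vp)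
    fix x assume x: "vnorm m x > 0"
    \<comment> \<open>At time 0, z^2 = -r^2 is real, so the \<open>Q\<close> part of the initial
      data vanishes.\<close>
    have "u 0 = (\<lambda>s. exp (- s\<^sup>2))" "w 0 = (\<lambda>s. 0)"
      by (simp_all add: u_def w_def exp_square_Complex fun_eq_iff)
    then show "?F x = comb (\<lambda>x. 0) g h x"
      using x by (simp add: comb_def rad_def g_def h_def dop_funpow_eq_D_r D_r_gaussian D_r_zero)
  qed
  have cmul_P: "cmul m (\<lambda>A. cscal a A + b * comega m x A) (P x) A = a * P x A + b / vnorm m x * Q x A" for a b x A
    unfolding Q_def by (rule cmul_cscal_comega) (rule P_outside)
  have "Ft m k (\<lambda>z. exp (z\<^sup>2)) P y A = real (dfact (2 * N)) * comb (\<lambda>y. y 0) ((dop ^^ N) u) ((dop ^^ N) w) y A" for A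
  proof -
    have "Ft m k (\<lambda>z. exp (z\<^sup>2)) P = (laplace m ^^ N) (comb (\<lambda>y. y 0) u w)"
      unfolding Ft_def cmul_P N_def comb_def rad_def u_def w_def ..
    moreover have "real (m + 2 * k) - 1 - 2 * real i = 2 * real N - 2 * real i" for i
      using N(2) by simp
    ultimately show ?thesis
      by (simp only: laplace_funpow_comb[OF vp assms(4)] dfact_double)
  qed
  moreover have "dfact (2 * N) \<noteq> 0"
    by (rule notI) (use dfact_double[of N] in \<open>simp add: prod_zero_iff\<close>)
  ultimately have 1: "CK m ?F y = (\<lambda>A. Ft m k (\<lambda>z. exp (z\<^sup>2)) P y A / ((-2) ^ N * real (dfact (2 * N))))"
    unfolding CK g_def h_def comb_cmult by (simp add: fun_eq_iff)
  have g: "g (y 0) ?r = exp ((y 0)\<^sup>2 - ?r\<^sup>2) *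
      (\<Sum>j\<in>{0..N}. real (N choose j) / (-2) ^ j * D_r j (\<lambda>s. cos (2 * y 0 * s)) ?r)"
    using D_r_exp_mult[OF D_r_cos_has_derivative assms(4)]
    by (simp add: g_def dop_funpow_eq_D_r u_def exp_square_Complex)
  \<comment> \<open>The division by \<open>?r\<close> is the one in omega P = Q / r; it also turns
    \<open>D_up\<close> of the sine into \<open>D_r\<close> of the sine divided by
    \<open>s\<close>.\<close>
  have h: "h (y 0) ?r = exp ((y 0)\<^sup>2 - ?r\<^sup>2) *
      (\<Sum>j\<in>{0..N}. real (N choose j) / (-2) ^ j * D_up j (\<lambda>s. sin (2 * y 0 * s)) ?r) / ?r"
  proof -
    have "(\<Sum>j\<in>{0..N}. real (N choose j) / (-2) ^ j * D_up j (\<lambda>s. sin (2 * y 0 * s)) ?r) / ?r =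
        (\<Sum>j\<in>{0..N}. real (N choose j) / (-2) ^ j * D_r j (\<lambda>s. sin (2 * y 0 * s) / s) ?r)"
      unfolding sum_divide_distrib using assms(4) by (intro sum.cong refl) (simp add: D_up_eq_D_r)
    moreover have "h (y 0) ?r = exp ((y 0)\<^sup>2 - ?r\<^sup>2) *
        (\<Sum>j\<in>{0..N}. real (N choose j) / (-2) ^ j * D_r j (\<lambda>s. sin (2 * y 0 * s) / s) ?r)"
      using D_r_exp_mult[OF D_r_sin_has_derivative assms(4), of N "(y 0)\<^sup>2" "y 0"]
      by (simp add: h_def dop_funpow_eq_D_r w_def exp_square_Complex)
    ultimately show ?thesis
      by (simp only: times_divide_eq_right[symmetric])
  qed
  have "CK m ?F y = (\<lambda>A. exp ((y 0)\<^sup>2 - ?r\<^sup>2) *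
      cmul m (\<lambda>B. cscal (\<Sum>j\<in>{0..N}. real (N choose j) / (-2) ^ j * D_r j (\<lambda>s. cos (2 * y 0 * s)) ?r) B
        + (\<Sum>j\<in>{0..N}. real (N choose j) / (-2) ^ j * D_up j (\<lambda>s. sin (2 * y 0 * s)) ?r) * comega m y B)
      (P y) A)"
    unfolding CK cmul_P comb_def rad_def g h by (simp add: distrib_left mult.assoc)
  with 1 show ?thesis
    unfolding N(1) N_def by blast
qed

end
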